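(* Consider the RIS-aided MIMO channel $\mathbf G=\sqrt{\beta_{\mathrm t}\beta_{\mathrm r}}\mathbf R\boldsymbol\Phi\mathbf T+\sqrt{\beta_{\mathrm d}}\mathbf H$ described in the context, with $N_{\mathrm r}\ge N_{\mathrm t}$, and let $C=\mathbb E\{\log_2\det(\mathbf I_{N_{\mathrm r}}+\bar\rho\,\mathbf G\mathbf G^{\dagger})\}$ with $\bar\rho=\rho/N_{\mathrm t}$, $\rho>0$. Then $$C\le\log_2\Big(\sum_{t=0}^{N_{\mathrm t}}\bar\rho^{\,t}\sum_{\mathcal Q\subseteq\{1,\dots,N_{\mathrm t}\},\,|\mathcal Q|=t}\det(\boldsymbol\Psi_{\mathcal Q})\,\mathsf J_{N_{\mathrm r}}\big(\tilde\theta_1,\dots,\tilde\theta_{L_{\mathcal Q}}\big)\frac{(N_{\mathrm r}-L_{\mathcal Q})!}{(N_{\mathrm r}-t)!}\Big),$$ where for each $\mathcal Q$, $\tilde\theta_1,\dots,\tilde\theta_{L_{\mathcal Q}}$ are the non-zero eigenvalues of $\boldsymbol\Psi_{\mathcal Q}^{-1}\boldsymbol\Sigma_{\mathcal Q}$ with $\boldsymbol\Sigma=\bar{\mathbf G}^{\dagger}\bar{\mathbf G}$.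
   Context: Setup: $N_{\mathrm t},N_{\mathrm r},M=M_{\mathrm h}M_{\mathrm v}$ positive integers; $\mathbf T\in\mathbb C^{M\times N_{\mathrm t}}$, $\bar{\mathbf R}\in\mathbb C^{N_{\mathrm r}\times M}$, $\bar{\mathbf H}\in\mathbb C^{N_{\mathrm r}\times N_{\mathrm t}}$ are line-of-sight matrices of the form $\mathbf T=\sum_{i=1}^{P_{\mathbf T}}\frac{t_i}{\sqrt{P_{\mathbf T}}}\mathbf a_{M_{\mathrm h},M_{\mathrm v}}(\varphi_{a_1,i},\theta_{a_1,i})\mathbf a_{N_{\mathrm t}}(\theta_{d_1,i})^\intercal$, $\bar{\mathbf R}=\sum_{i=1}^{P_{\mathbf R}}\frac{r_i}{\sqrt{P_{\mathbf R}}}\mathbf a_{N_{\mathrm r}}(\theta_{a_2,i})\mathbf a_{M_{\mathrm h},M_{\mathrm v}}(\varphi_{d_2,i},\theta_{d_2,i})^\intercal$, $\bar{\mathbf H}=\sum_{i=1}^{P_{\mathbf H}}\frac{h_i}{\sqrt{P_{\mathbf H}}}\mathbf a_{N_{\mathrm r}}(\theta_{a_3,i})\mathbf a_{N_{\mathrm t}}(\theta_{d_3,i})^\intercal$, where $\mathbf a_N(\theta)=[e^{\mathsf j2\pi(n-1)\frac{d}{\lambda}\sin\theta}]_{n=1}^{N}$ (column; $d=d_{\mathrm t}$ for $N_{\mathrm t}$, $d=d_{\mathrm r}$ for $N_{\mathrm r}$) and $\mathbf a_{M_{\mathrm h},M_{\mathrm v}}(\varphi,\theta)^\intercal=[e^{\mathsf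 j2\pi(m-1)\frac{d_{\mathrm v}}{\lambda}\sin\theta}]_{m=1}^{M_{\mathrm v}}\otimes[e^{\mathsf j2\pi(n-1)\frac{d_{\mathrm h}}{\lambda}\cos\theta\sin\varphi}]_{n=1}^{M_{\mathrm h}}$. The gains $t_i,r_i,h_i$ (i.i.d. $\mathcal{CN}(0,1)$ in the model) and all angles are treated as fixed (the result is conditional on them). $\boldsymbol\Phi=\mathrm{diag}\{e^{\mathsf j\theta_1},\dots,e^{\mathsf j\theta_M}\}$ is fixed. $\beta_{\mathrm t},\beta_{\mathrm r},\beta_{\mathrm d}>0$; $L_{\mathbf R}+N_{\mathbf R}=1$, $L_{\mathbf H}+N_{\mathbf H}=1$, all $\ge0$, and $N_{\mathbf H}>0$. $\mathbf R=\sqrt{L_{\mathbf R}}\bar{\mathbf R}+\sqrt{N_{\mathbf R}}\tilde{\mathbf R}$, $\mathbf H=\sqrt{L_{\mathbf H}}\bar{\mathbf H}+\sqrt{N_{\mathbf H}}\tilde{\mathbf H}$ with $\tilde{\mathbf R},\tilde{\mathbf H}$ independent with i.i.d. $\mathcal{CN}(0,1)$ entries; the expectation is over $\tilde{\mathbf R},\tilde{\mathbf H}$. Define $\bar{\mathbf G}=\sqrt{\beta_{\mathrm t}\beta_{\mathrm r}L_{\mathbf R}}\bar{\mathbf R}\boldsymbol\Phi\mathbf T+\sqrt{\beta_{\mathrm d}L_{\mathbf H}}\bar{\mathbf H}$ and $\boldsymbol\Psi=\beta_{\mathrm t}\beta_{\mathrm r}N_{\mathbf R}\mathbf T^{\dagger}\mathbf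 T+\beta_{\mathrm d}N_{\mathbf H}\mathbf I_{N_{\mathrm t}}$. For a square matrix $\mathbf A$ and index set $\mathcal Q$, $\mathbf A_{\mathcal Q}$ is the principal submatrix with rows and columns indexed by $\mathcal Q$ (for $\mathcal Q=\emptyset$ its determinant is $1$). For an integer $q$ and numbers $\theta_1,\dots,\theta_L$: $\mathsf J_q(\theta_1,\dots,\theta_L)=\det(\boldsymbol\Delta)/V(\theta_1,\dots,\theta_L)$, where $\boldsymbol\Delta\in\mathbb C^{L\times L}$ has $(i,j)$ entry $(q-L+j+\theta_i)\theta_i^{j-1}$ and $V(\theta_1,\dots,\theta_L)=\prod_{i<j\le L}(\theta_j-\theta_i)$; $\mathsf J_q=1$ when $L=0$, and when eigenvalues coincide the ratio is understood as its limit. *)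

theory Defs
  imports "HOL-Probability.Probability" "Jordan_Normal_Form.Jordan_Normal_Form"
begin

definition ctrans :: "complex mat \<Rightarrow> complex mat" where
  "ctrans A = mat (dim_col A) (dim_row A) (\<lambda>(i,j). cnj (A $$ (j,i)))"

text \<open>Matrix inverse (only used for invertible matrices).\<close>
definition minv :: "complex mat \<Rightarrow> complex mat" where
  "minv A = the (mat_inverse A)"

definition principal_submat :: "complex mat \<Rightarrow> nat set \<Rightarrow> complex mat" where
  "principal_submat A Q = mat (card Q) (card Q)
     (\<lambda>(i,j). A $$ (sorted_list_of_set Q ! i, sorted_list_of_set Q ! j))"

definition eigvals :: "complex mat \<Rightarrow> complex list" where
  "eigvals A = (SOME as. length as = dim_row A \<and> char_poly A = (\<Prod>a\<leftarrow>as. [:- a, 1:]))"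

definition nonzero_eigvals :: "complex mat \<Rightarrow> complex list" where
  "nonzero_eigvals A = filter (\<lambda>x. x \<noteq> 0) (eigvals A)"

definition J_raw :: "int \<Rightarrow> complex list \<Rightarrow> complex" where
  "J_raw q ths = (let L = length ths in
     det (mat L L (\<lambda>(i,j). (of_int q - of_nat L + of_nat (j+1) + ths ! i) * (ths ! i) ^ j))
     / (\<Prod>j<L. \<Prod>i<j. (ths ! j - ths ! i)))"

text \<open>J with the value at coinciding arguments understood as a limit: we take the limit
  along the perturbation th_i + s*i (s -> 0), along which the arguments are pairwise
  distinct for all small s \<noteq> 0.  For distinct arguments this is just J_raw
  (the ratio is a polynomial, hence continuous).\<close>
definition J :: "int \<Rightarrow> complex list \<Rightarrow> complex" where
  "J q ths = Lim (at (0::complex)) (\<lambda>s. J_raw q (map (\<lambda>(i,x). x + s * of_nat i) (List.enumerate 0 ths)))"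

text \<open>ULA response a_N(theta), n-th (0-based) entry exp(j 2 pi n (d/lambda) sin theta);
  dl = d/lambda.\<close>
definition ula :: "real \<Rightarrow> real \<Rightarrow> nat \<Rightarrow> complex" where
  "ula dl th n = cis (2 * pi * real n * dl * sin th)"

text \<open>UPA response a_{Mh,Mv}(phi,theta): Kronecker product (vertical) \<otimes> (horizontal),
  entry at 0-based index m*Mh + n is
  exp(j 2 pi m (dv/lambda) sin theta) * exp(j 2 pi n (dh/lambda) cos theta sin phi).\<close>
definition upa :: "nat \<Rightarrow> real \<Rightarrow> real \<Rightarrow> real \<Rightarrow> real \<Rightarrow> nat \<Rightarrow> complex" where
  "upa Mh dhl dvl ph th k =
     cis (2 * pi * real (k div Mh) * dvl * sin th) * cis (2 * pi * real (k mod Mh) * dhl * cos th * sin ph)"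

definition LoS_T :: "nat \<Rightarrow> nat \<Rightarrow> nat \<Rightarrow> real \<Rightarrow> real \<Rightarrow> real \<Rightarrow> nat \<Rightarrow> (nat \<Rightarrow> complex)
    \<Rightarrow> (nat \<Rightarrow> real) \<Rightarrow> (nat \<Rightarrow> real) \<Rightarrow> (nat \<Rightarrow> real) \<Rightarrow> complex mat" where
  "LoS_T Mh Mv Nt dhl dvl dtl P g phA thA thD = mat (Mh * Mv) Nt (\<lambda>(k,l).
     \<Sum>i<P. g i / complex_of_real (sqrt (real P)) * upa Mh dhl dvl (phA i) (thA i) k * ula dtl (thD i) l)"

definition LoS_R :: "nat \<Rightarrow> nat \<Rightarrow> nat \<Rightarrow> real \<Rightarrow> real \<Rightarrow> real \<Rightarrow> nat \<Rightarrow> (nat \<Rightarrow> complex)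
    \<Rightarrow> (nat \<Rightarrow> real) \<Rightarrow> (nat \<Rightarrow> real) \<Rightarrow> (nat \<Rightarrow> real) \<Rightarrow> complex mat" where
  "LoS_R Mh Mv Nr dhl dvl drl P g thA phD thD = mat Nr (Mh * Mv) (\<lambda>(k,l).
     \<Sum>i<P. g i / complex_of_real (sqrt (real P)) * ula drl (thA i) k * upa Mh dhl dvl (phD i) (thD i) l)"

definition LoS_H :: "nat \<Rightarrow> nat \<Rightarrow> real \<Rightarrow> real \<Rightarrow> nat \<Rightarrow> (nat \<Rightarrow> complex)
    \<Rightarrow> (nat \<Rightarrow> real) \<Rightarrow> (nat \<Rightarrow> real) \<Rightarrow> complex mat" where
  "LoS_H Nr Nt drl dtl P g thA thD = mat Nr Nt (\<lambda>(k,l).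
     \<Sum>i<P. g i / complex_of_real (sqrt (real P)) * ula drl (thA i) k * ula dtl (thD i) l)"

definition ris_phase :: "nat \<Rightarrow> (nat \<Rightarrow> real) \<Rightarrow> complex mat" where
  "ris_phase M th = mat M M (\<lambda>(i,j). if i = j then cis (th i) else 0)"

definition cgauss :: "complex measure" where
  "cgauss = density lborel (\<lambda>z. ennreal (exp (- (cmod z)\<^sup>2) / pi))"

definition cgauss_mat_measure :: "nat \<Rightarrow> nat \<Rightarrow> (nat \<times> nat \<Rightarrow> complex) measure" where
  "cgauss_mat_measure m n = PiM ({..<m} \<times> {..<n}) (\<lambda>_. cgauss)"

definition to_mat :: "nat \<Rightarrow> nat \<Rightarrow> (nat \<times> nat \<Rightarrow> complex) \<Rightarrow> complex mat" where
  "to_mat m n w = mat m n w"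

end

theory Submission
  imports Defs
begin

text \<open>
  By Jensen's inequality it suffices to compute the expectation of
  \<open>det (I + \<rho> G G\<^sup>\<dagger>) = det (I + \<rho> G\<^sup>\<dagger> G)\<close>, which is the sum over \<open>Q\<close> of
  \<open>\<rho> ^ card Q\<close> times the principal minor \<open>det ((G\<^sup>\<dagger> G)\<^sub>Q)\<close>.

  Each row of \<open>G\<^sup>\<dagger> G\<close> is a sum over the rows of \<open>G\<close>. By multilinearity the minor is a sum over
  maps \<open>f\<close> from \<open>Q\<close> to the rows of \<open>G\<close>, and only injective \<open>f\<close> survive, since otherwise two rows
  are proportional. The rows of \<open>G\<close> are independent, so for injective \<open>f\<close> the expectation may be
  taken factor by factor; this replaces \<open>cnj (G\<^bsub>r i\<^esub>) G\<^bsub>r j\<^esub>\<close> by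
  \<open>\<Psi>\<^bsub>i j\<^esub> + cnj (B\<^bsub>r i\<^esub>) B\<^bsub>r j\<^esub>\<close>, where \<open>B\<close> is the mean of \<open>G\<close>. Expanding again by
  multilinearity and counting the injective extensions of a map defined on \<open>U \<subseteq> Q\<close> gives, with \<open>n\<close>
  the number of rows of \<open>G\<close>, the sum over \<open>U\<close> of \<open>(n - card U)! / (n - card Q)!\<close> times the
  determinant with the rows of \<open>\<Sigma> = B\<^sup>\<dagger> B\<close> on \<open>U\<close> and the rows of \<open>\<Psi>\<close> off \<open>U\<close>. These
  determinants are collected by the polynomial \<open>det (\<Sigma>\<^sub>Q + y \<Psi>\<^sub>Q) = det \<Psi>\<^sub>Q \<Prod>\<^sub>i (y + \<theta>\<^sub>i)\<close> in \<open>y\<close>,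
  and the factorials are the values on monomials of the functional \<open>p \<mapsto> \<integral> s\<^sup>a p(s) exp (- s) ds\<close>. The
  same functional, applied to the product over the non-zero \<open>\<theta>\<^sub>i\<close> only, yields \<open>J\<close>: expanding the
  determinant in the definition of \<open>J\<close> by columns leaves Vandermonde determinants with one exponent
  omitted, which are elementary symmetric functions of the \<open>\<theta>\<^sub>i\<close> times the Vandermonde determinant.
\<close>

section \<open>Determinants over finite index sets\<close>

definition det_on :: "'i set \<Rightarrow> ('i \<Rightarrow> 'i \<Rightarrow> 'a::comm_ring_1) \<Rightarrow> 'a" where
  "det_on S a = (\<Sum>p | p permutes S. of_int (sign p) * (\<Prod>i\<in>S. a i (p i)))"

lemma det_on_cong:
  assumes "\<And>i j. i \<in> S \<Longrightarrow> j \<in> S \<Longrightarrow> a i j = b i j"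
  shows "det_on S a = det_on S b"
  unfolding det_on_def
  by (intro sum.cong refl arg_cong2[where f = "(*)"] prod.cong)
     (auto simp: assms permutes_in_image)

lemma det_eq_det_on:
  assumes "A \<in> carrier_mat n n"
  shows "det A = det_on {..<n} (\<lambda>i j. A $$ (i, j))"
  using det_def'[OF assms] by (simp add: det_on_def lessThan_atLeast0)

lemma det_mat_eq_det_on: "det (mat n n (\<lambda>(i, j). a i j)) = det_on {..<n} a"
  by (subst det_eq_det_on[of _ n]) (auto intro: det_on_cong)

lemma det_on_bij_betw:
  assumes bij: "bij_betw f A B" and fin: "finite A"
  shows "det_on A (\<lambda>i j. a (f i) (f j)) = det_on B a"
  unfolding det_on_def
proof (rule sum.reindex_bij_witness[where i = "map_permutation B (inv_into A f)"
      and j = "map_permutation A f"])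
  have inj: "inj_on f A" and im: "f ` A = B" and inv: "bij_betw (inv_into A f) B A"
    using bij bij_betw_inv_into[OF bij] by (auto simp: bij_betw_def)
  {
    fix p assume "p \<in> {p. p permutes A}"
    then have p: "p permutes A" by simp
    show "map_permutation A f p \<in> {p. p permutes B}"
      using map_permutation_permutes[OF bij p] by simp
    show "map_permutation B (inv_into A f) (map_permutation A f p) = p"
      by (rule map_permutation_compose_inv[OF bij p]) (use inj in auto)
    have "(\<Prod>i\<in>B. a i (map_permutation A f p i)) = (\<Prod>i\<in>A. a (f i) (f (p i)))"
      by (simp add: prod.reindex_bij_betw[OF bij, symmetric] map_permutation_apply[OF inj])
    then show "of_int (sign (map_permutation A f p)) * (\<Prod>i\<in>B. a i (map_permutation A f p i)) =
        of_int (sign p) * (\<Prod>i\<in>A. a (f i) (f (p i)))"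
      using sign_map_permutation[OF inj p fin] by simp
  next
    fix q assume "q \<in> {p. p permutes B}"
    then have q: "q permutes B" by simp
    show "map_permutation B (inv_into A f) q \<in> {p. p permutes A}"
      using map_permutation_permutes[OF inv q] by simp
    show "map_permutation A f (map_permutation B (inv_into A f) q) = q"
      by (rule map_permutation_compose_inv[OF inv q]) (use im in \<open>auto simp: f_inv_into_f\<close>)
  }
qed

lemma det_mat_bij_betw:
  assumes "bij_betw f {..<n} S"
  shows "det (mat n n (\<lambda>(i, j). a (f i) (f j))) = det_on S a"
  unfolding det_mat_eq_det_on using assms by (rule det_on_bij_betw) simp

lemma bij_betw_nth_sorted_list_of_set:
  assumes "finite Q"
  shows "bij_betw ((!) (sorted_list_of_set Q)) {..<card Q} Q"
  using bij_betw_nth[of "sorted_list_of_set Q" "{..<card Q}" Q] assms by simp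

lemma principal_submat_carrier: "principal_submat A Q \<in> carrier_mat (card Q) (card Q)"
  by (simp add: principal_submat_def)

lemma prod_override_on:
  assumes "finite S" "U \<subseteq> S"
  shows "(\<Prod>i\<in>S. override_on b a U i (p i)) = (\<Prod>i\<in>U. a i (p i)) * (\<Prod>i\<in>S - U. b i (p i))"
proof -
  have "S \<inter> U = U" "S \<inter> - U = S - U"
    using assms by auto
  then show ?thesis
    using prod.If_cases[OF assms(1), of "\<lambda>i. i \<in> U" "\<lambda>i. a i (p i)" "\<lambda>i. b i (p i)"]
    by (simp add: override_on_def if_distrib[of "\<lambda>r. r _"])
qed

lemma det_on_add:
  assumes "finite S"
  shows "det_on S (\<lambda>i j. a i j + b i j) = (\<Sum>U\<in>Pow S. det_on S (override_on b a U))"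
proof -
  have "(\<Prod>i\<in>S. a i (p i) + b i (p i)) = (\<Sum>U\<in>Pow S. \<Prod>i\<in>S. override_on b a U i (p i))" for p
    unfolding prod_add[OF assms] by (intro sum.cong refl) (simp add: prod_override_on[OF assms])
  then show ?thesis
    unfolding det_on_def by (simp add: sum_distrib_left) (rule sum.swap)
qed

lemma det_on_sum_rows:
  assumes "finite S" "U \<subseteq> S" "finite R"
  shows "det_on S (override_on b (\<lambda>i j. \<Sum>r\<in>R. c r i j) U) =
    (\<Sum>f\<in>U \<rightarrow>\<^sub>E R. det_on S (override_on b (\<lambda>i. c (f i) i) U))"
proof -
  have "finite U"
    using assms finite_subset by auto
  then have "(\<Prod>i\<in>S. override_on b (\<lambda>i j. \<Sum>r\<in>R. c r i j) U i (p i)) =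
      (\<Sum>f\<in>U \<rightarrow>\<^sub>E R. \<Prod>i\<in>S. override_on b (\<lambda>i. c (f i) i) U i (p i))" for p
    using assms by (simp add: prod_override_on prod_sum_PiE sum_distrib_right)
  then show ?thesis
    unfolding det_on_def by (simp add: sum_distrib_left) (rule sum.swap)
qed

lemma det_on_scale_rows: "det_on S (\<lambda>i j. c i * a i j) = (\<Prod>i\<in>S. c i) * det_on S a"
  unfolding det_on_def by (simp add: prod.distrib sum_distrib_left mult_ac)

lemma det_on_scale_overridden_rows:
  assumes "finite S" "U \<subseteq> S"
  shows "det_on S (override_on b (\<lambda>i j. c i * a i j) U) =
    (\<Prod>i\<in>U. c i) * det_on S (override_on b a U)"
  unfolding det_on_def
  by (simp add: prod_override_on[OF assms] prod.distrib sum_distrib_left mult_ac)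

lemma det_on_identical_rows:
  assumes "finite S" "i \<in> S" "k \<in> S" "i \<noteq> k" "a i = a k"
  shows "det_on S a = 0"
proof -
  obtain f where f: "bij_betw f {..<card S} S"
    using ex_bij_betw_nat_finite[OF assms(1)] by (auto simp: lessThan_atLeast0)
  then obtain i' k' where "i' < card S" "f i' = i" "k' < card S" "f k' = k"
    using assms(2,3) by (metis bij_betw_def imageE lessThan_iff)
  then have "det (mat (card S) (card S) (\<lambda>(i, j). a (f i) (f j))) = 0"
    using assms(4,5) by (intro det_identical_rows[of _ "card S" i' k']) auto
  then show ?thesis
    by (simp add: det_mat_bij_betw[OF f])
qed

lemma det_on_override_identity_rows:
  assumes "finite S" "Q \<subseteq> S"
  shows "det_on S (override_on (\<lambda>i j. if i = j then 1 else 0) a Q) = det_on Q a"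
proof -
  let ?b = "override_on (\<lambda>i j. if i = j then 1 else 0) a Q"
  have "(\<Prod>i\<in>S. ?b i (p i)) = (\<Prod>i\<in>Q. a i (p i))" if "p permutes Q" for p
    unfolding prod_override_on[OF assms] using that by (simp add: permutes_not_in)
  then have "det_on Q a = (\<Sum>p | p permutes Q. of_int (sign p) * (\<Prod>i\<in>S. ?b i (p i)))"
    unfolding det_on_def by (intro sum.cong) auto
  also have "\<dots> = det_on S ?b"
    unfolding det_on_def
  proof (intro sum.mono_neutral_left ballI)
    show "finite {p. p permutes S}"
      by (rule finite_permutations) fact
    show "{p. p permutes Q} \<subseteq> {p. p permutes S}"
      using assms permutes_subset by blast
    fix p assume "p \<in> {p. p permutes S} - {p. p permutes Q}"
    then obtain i where "i \<in> S - Q" "p i \<noteq> i"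
      using permutes_superset[of p S Q] by auto
    then have "(\<Prod>i\<in>S. ?b i (p i)) = 0"
      using assms by (intro prod_zero bexI[of _ i]) auto
    then show "of_int (sign p) * (\<Prod>i\<in>S. ?b i (p i)) = 0"
      by simp
  qed
  finally show ?thesis ..
qed

lemma det_on_identity_plus:
  assumes "finite S"
  shows "det_on S (\<lambda>i j. (if i = j then 1 else 0) + c * a i j) =
    (\<Sum>Q\<in>Pow S. c ^ card Q * det_on Q a)"
proof -
  have "det_on S (\<lambda>i j. c * a i j + (if i = j then 1 else 0)) =
      (\<Sum>Q\<in>Pow S. det_on Q (\<lambda>i j. c * a i j))"
    unfolding det_on_add[OF assms]
    by (intro sum.cong refl det_on_override_identity_rows) (use assms in auto)
  then show ?thesis
    by (simp add: det_on_scale_rows add.commute)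
qed

section \<open>Gram determinants\<close>

abbreviation inj_PiE :: "'i set \<Rightarrow> 'r set \<Rightarrow> ('i \<Rightarrow> 'r) set" where
  "inj_PiE S R \<equiv> {f \<in> S \<rightarrow>\<^sub>E R. inj_on f S}"

lemma sum_restrict_inj_PiE_insert:
  fixes G :: "('i \<Rightarrow> 'r) \<Rightarrow> 'a::comm_semiring_1"
  assumes "finite S" "finite R" "x \<notin> S"
  shows "(\<Sum>f\<in>inj_PiE (insert x S) R. G (restrict f S)) =
    of_nat (card R - card S) * (\<Sum>f\<in>inj_PiE S R. G f)"
proof -
  have "(\<Sum>f\<in>inj_PiE (insert x S) R. G (restrict f S)) =
      (\<Sum>(y, f)\<in>{(y, f). y \<in> R \<and> f \<in> S \<rightarrow>\<^sub>E (R - {y}) \<and> inj_on f S}. G f)"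
    unfolding extensional_funcset_extend_domain_inj_on_eq[OF assms(3)]
    using assms(3)
    by (subst sum.reindex[OF extensional_funcset_extend_domain_inj_onI])
       (auto intro!: sum.cong arg_cong[of _ _ G] simp: restrict_upd)
  also have "\<dots> = (\<Sum>(f, y)\<in>(SIGMA f:inj_PiE S R. R - f ` S). G f)"
    by (rule sum.reindex_bij_witness[of _ prod.swap prod.swap]) (auto simp: PiE_iff)
  also have "\<dots> = (\<Sum>f\<in>inj_PiE S R. \<Sum>y\<in>R - f ` S. G f)"
    using assms by (subst sum.Sigma) (auto intro: finite_subset[OF _ finite_PiE[of S "\<lambda>_. R"]])
  also have "\<dots> = (\<Sum>f\<in>inj_PiE S R. of_nat (card R - card S) * G f)"
  proof (intro sum.cong refl)
    fix f assume "f \<in> inj_PiE S R"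
    then have "card (R - f ` S) = card R - card S"
      using assms by (subst card_Diff_subset) (auto simp: card_image)
    then show "(\<Sum>y\<in>R - f ` S. G f) = of_nat (card R - card S) * G f"
      by simp
  qed
  finally show ?thesis
    by (simp add: sum_distrib_left)
qed

lemma sum_restrict_inj_PiE_Un:
  fixes G :: "('i \<Rightarrow> 'r) \<Rightarrow> 'a::{comm_semiring_1, semiring_char_0}"
  assumes "finite U" "finite D" "finite R" "U \<inter> D = {}" "card (U \<union> D) \<le> card R"
  shows "fact (card R - card (U \<union> D)) * (\<Sum>f\<in>inj_PiE (U \<union> D) R. G (restrict f U)) =
    fact (card R - card U) * (\<Sum>f\<in>inj_PiE U R. G f)"
  using assms(2,4,5)
proof (induction D rule: finite_induct)
  case empty
  have "(\<Sum>f\<in>inj_PiE U R. G (restrict f U)) = (\<Sum>f\<in>inj_PiE U R. G f)"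
    by (rule sum.cong) (auto simp only: PiE_restrict)
  then show ?case
    by (simp only: Un_empty_right)
next
  case (insert x D)
  let ?S = "U \<union> D" and ?n = "card R"
  have S: "finite ?S" "x \<notin> ?S"
    using insert assms by auto
  then have card_insert: "card (insert x ?S) = Suc (card ?S)"
    by simp
  have "restrict (restrict f ?S) U = restrict f U" for f :: "'i \<Rightarrow> 'r"
    by (simp add: Int_absorb1)
  then have "(\<Sum>f\<in>inj_PiE (insert x ?S) R. G (restrict f U)) =
      of_nat (?n - card ?S) * (\<Sum>f\<in>inj_PiE ?S R. G (restrict f U))"
    using sum_restrict_inj_PiE_insert[OF S(1) assms(3) S(2), of "\<lambda>f. G (restrict f U)"] by simp
  moreover have "(fact (?n - card ?S) :: 'a) =
      of_nat (?n - card ?S) * fact (?n - card (insert x ?S))"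
    using insert.prems(2) card_insert by (subst fact_reduce) auto
  ultimately have "fact (?n - card (insert x ?S)) * (\<Sum>f\<in>inj_PiE (insert x ?S) R. G (restrict f U)) =
      fact (?n - card ?S) * (\<Sum>f\<in>inj_PiE ?S R. G (restrict f U))"
    by (simp add: mult_ac)
  also have "\<dots> = fact (?n - card U) * (\<Sum>f\<in>inj_PiE U R. G f)"
    by (rule insert.IH) (use insert.prems card_insert in auto)
  finally show ?case
    by (simp only: Un_insert_right)
qed

lemma det_on_gram_rows:
  fixes u v :: "'r \<Rightarrow> 'i \<Rightarrow> 'a::comm_ring_1"
  assumes "finite S" "U \<subseteq> S" "finite R"
  shows "det_on S (override_on b (\<lambda>i j. \<Sum>r\<in>R. u r i * v r j) U) =
    (\<Sum>f\<in>inj_PiE U R. det_on S (override_on b (\<lambda>i j. u (f i) i * v (f i) j) U))"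
proof -
  have "det_on S (override_on b (\<lambda>i j. u (f i) i * v (f i) j) U) = 0" if "\<not> inj_on f U" for f
  proof -
    from that obtain i k where "i \<in> U" "k \<in> U" "i \<noteq> k" "f i = f k"
      by (auto simp: inj_on_def)
    then have "det_on S (override_on b (\<lambda>i j. v (f i) j) U) = 0"
      using assms by (intro det_on_identical_rows[of _ i k]) auto
    then show ?thesis
      by (simp add: det_on_scale_overridden_rows[OF assms(1,2)])
  qed
  moreover have "finite U"
    using assms finite_subset by auto
  ultimately show ?thesis
    unfolding det_on_sum_rows[OF assms]
    by (intro sum.mono_neutral_right) (use assms in \<open>auto intro!: finite_PiE\<close>)
qed

lemma det_on_gram:
  fixes u v :: "'r \<Rightarrow> 'i \<Rightarrow> 'a::comm_ring_1"
  assumes "finite S" "finite R"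
  shows "det_on S (\<lambda>i j. \<Sum>r\<in>R. u r i * v r j) =
    (\<Sum>f\<in>inj_PiE S R. det_on S (\<lambda>i j. u (f i) i * v (f i) j))"
proof -
  have override_all: "det_on S (override_on (\<lambda>_ _. 0) a S) = det_on S a" for a :: "'i \<Rightarrow> 'i \<Rightarrow> 'a"
    by (rule det_on_cong) simp
  show ?thesis
    using det_on_gram_rows[OF assms(1) order_refl assms(2), of "\<lambda>_ _. 0" u v]
    by (simp only: override_all)
qed

lemma sum_det_on_shifted_gram:
  fixes u v :: "'r \<Rightarrow> 'i \<Rightarrow> 'a::{comm_ring_1, ring_char_0}"
  assumes "finite Q" "finite R" "card Q \<le> card R"
  shows "fact (card R - card Q) * (\<Sum>f\<in>inj_PiE Q R. det_on Q (\<lambda>i j. \<psi> i j + u (f i) i * v (f i) j)) =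
    (\<Sum>U\<in>Pow Q. fact (card R - card U) * det_on Q (override_on \<psi> (\<lambda>i j. \<Sum>r\<in>R. u r i * v r j) U))"
proof -
  define G where "G U f = det_on Q (override_on \<psi> (\<lambda>i j. u (f i) i * v (f i) j) U)" for U f
  have G_restrict: "G U (restrict f U) = G U f" for U f
    unfolding G_def by (rule det_on_cong) (simp add: override_on_def)
  have "(\<Sum>f\<in>inj_PiE Q R. det_on Q (\<lambda>i j. \<psi> i j + u (f i) i * v (f i) j)) =
      (\<Sum>f\<in>inj_PiE Q R. \<Sum>U\<in>Pow Q. G U f)"
    unfolding G_def by (simp only: det_on_add[OF assms(1), symmetric] add.commute)
  also have "\<dots> = (\<Sum>U\<in>Pow Q. \<Sum>f\<in>inj_PiE Q R. G U f)"
    by (rule sum.swap)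
  also have "fact (card R - card Q) * \<dots> =
      (\<Sum>U\<in>Pow Q. fact (card R - card Q) * (\<Sum>f\<in>inj_PiE Q R. G U f))"
    by (rule sum_distrib_left)
  also have "\<dots> = (\<Sum>U\<in>Pow Q. fact (card R - card U) * (\<Sum>f\<in>inj_PiE U R. G U f))"
  proof (intro sum.cong refl)
    fix U assume "U \<in> Pow Q"
    then have U: "U \<union> (Q - U) = Q" "finite U"
      using assms finite_subset by auto
    then show "fact (card R - card Q) * (\<Sum>f\<in>inj_PiE Q R. G U f) =
        fact (card R - card U) * (\<Sum>f\<in>inj_PiE U R. G U f)"
      using sum_restrict_inj_PiE_Un[of U "Q - U" R "G U"] assms by (simp add: G_restrict)
  qed
  also have "\<dots> = (\<Sum>U\<in>Pow Q. fact (card R - card U) *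
      det_on Q (override_on \<psi> (\<lambda>i j. \<Sum>r\<in>R. u r i * v r j) U))"
    unfolding G_def by (intro sum.cong refl) (use assms in \<open>simp add: det_on_gram_rows\<close>)
  finally show ?thesis .
qed

section \<open>Vandermonde determinants with a gap\<close>

definition gap_vandermonde :: "nat \<Rightarrow> nat \<Rightarrow> (nat \<Rightarrow> 'a) \<Rightarrow> 'a::comm_ring_1" where
  "gap_vandermonde L m x = det (mat L L (\<lambda>(i, k). x i ^ (if k < m then k else Suc k)))"

lemma gap_vandermonde_cong:
  assumes "\<And>i. i < L \<Longrightarrow> x i = y i"
  shows "gap_vandermonde L m x = gap_vandermonde L m y"
  unfolding gap_vandermonde_def by (rule arg_cong[of _ _ det], rule eq_matI) (auto simp: assms)

lemma gap_vandermonde_last: "gap_vandermonde L L x = det (mat L L (\<lambda>(i, j). x i ^ j))"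
  unfolding gap_vandermonde_def by (rule arg_cong[of _ _ det], rule eq_matI) auto

lemma gap_vandermonde_eq_0:
  assumes "\<not> inj_on x {..<L}"
  shows "gap_vandermonde L m x = 0"
proof -
  from assms obtain i k where "i < L" "k < L" "i \<noteq> k" "x i = x k"
    by (auto simp: inj_on_def)
  then show ?thesis
    unfolding gap_vandermonde_def by (intro det_identical_rows[of _ L i k]) auto
qed

lemma gap_vandermonde_eq_det_on:
  "gap_vandermonde L m x =
    det_on {..<L} (override_on (\<lambda>j i. x i ^ Suc j) (\<lambda>j i. x i ^ j) {..<m})"
proof -
  let ?A = "mat L L (\<lambda>(i, k). x i ^ (if k < m then k else Suc k))"
  have "gap_vandermonde L m x = det (transpose_mat ?A)"
    unfolding gap_vandermonde_def by (rule det_transpose[of _ L, symmetric]) simp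
  also have "\<dots> = det_on {..<L} (override_on (\<lambda>j i. x i ^ Suc j) (\<lambda>j i. x i ^ j) {..<m})"
    by (subst det_eq_det_on[of _ L]) (auto intro!: det_on_cong simp: override_on_def)
  finally show ?thesis .
qed

lemma det_vandermonde_laplace:
  "det (mat (Suc L) (Suc L) (\<lambda>(i, j). x i ^ j)) =
    (-1) ^ L * (\<Sum>m\<le>L. (- x L) ^ m * gap_vandermonde L m x)"
proof -
  let ?V = "mat (Suc L) (Suc L) (\<lambda>(i, j). x i ^ j)"
  have "mat_delete ?V L m = mat L L (\<lambda>(i, k). x i ^ (if k < m then k else Suc k))" if "m \<le> L" for m
    by (rule eq_matI) (use that in \<open>auto simp: mat_delete_def\<close>)
  then have "cofactor ?V L m = (-1) ^ (L + m) * gap_vandermonde L m x" if "m \<le> L" for m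
    using that by (simp add: cofactor_def gap_vandermonde_def)
  moreover have "det ?V = (\<Sum>m<Suc L. ?V $$ (L, m) * cofactor ?V L m)"
    by (rule laplace_expansion_row) auto
  ultimately show ?thesis
    by (simp add: lessThan_Suc_atMost power_minus[of "x L"] power_add sum_distrib_left mult_ac)
qed

lemma poly_sum_gap_vandermonde:
  "poly (\<Sum>m\<le>L. monom (gap_vandermonde L m x) m) y =
    (-1) ^ L * det (mat (Suc L) (Suc L) (\<lambda>(i, j). (x(L := - y)) i ^ j))"
proof -
  have "gap_vandermonde L m (x(L := - y)) = gap_vandermonde L m x" for m
    by (rule gap_vandermonde_cong) simp
  then show ?thesis
    unfolding det_vandermonde_laplace
    by (simp add: poly_sum poly_monom fun_upd_same mult.commute del: fun_upd_apply
        flip: mult.assoc power_mult_distrib)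
qed

lemma degree_prod_linear:
  fixes x :: "nat \<Rightarrow> 'a::idom"
  shows "degree (\<Prod>i<L. [:x i, 1:]) = L"
  by (subst degree_prod_eq_sum_degree) auto

lemma sum_gap_vandermonde_eq_smult:
  fixes x :: "nat \<Rightarrow> 'a::idom"
  assumes inj: "inj_on x {..<L}"
  shows "(\<Sum>m\<le>L. monom (gap_vandermonde L m x) m) =
    Polynomial.smult (gap_vandermonde L L x) (\<Prod>i<L. [:x i, 1:])" (is "?p = Polynomial.smult ?c ?q")
proof (rule poly_eqI_degree_lead_coeff[where n = L and A = "(\<lambda>i. - x i) ` {..<L}"])
  fix y assume "y \<in> (\<lambda>i. - x i) ` {..<L}"
  then obtain i where i: "i < L" "y = - x i"
    by auto
  then have "poly ?p y = 0"
    unfolding poly_sum_gap_vandermonde by (subst det_identical_rows[of _ "Suc L" i L]) auto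
  moreover have "poly ?q y = 0"
    using i by (auto simp: poly_prod intro!: prod_zero)
  ultimately show "poly ?p y = poly (Polynomial.smult ?c ?q) y"
    by simp
next
  have "lead_coeff ?q = 1"
    unfolding lead_coeff_prod by simp
  then show "coeff ?p L = coeff (Polynomial.smult ?c ?q) L"
    by (simp add: coeff_sum degree_prod_linear)
  have "inj_on (\<lambda>i. - x i) {..<L}"
    using inj by (auto simp: inj_on_def)
  then show "L \<le> card ((\<lambda>i. - x i) ` {..<L})"
    by (simp add: card_image)
  show "degree ?p \<le> L"
    by (rule degree_le) (simp add: coeff_sum)
  show "degree (Polynomial.smult ?c ?q) \<le> L"
    by (simp add: degree_prod_linear)
qed

lemma gap_vandermonde_eq_coeff:
  fixes x :: "nat \<Rightarrow> 'a::idom"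
  assumes "m \<le> L"
  shows "gap_vandermonde L m x = gap_vandermonde L L x * coeff (\<Prod>i<L. [:x i, 1:]) m"
proof (cases "inj_on x {..<L}")
  case True
  from arg_cong[OF sum_gap_vandermonde_eq_smult[OF this], of "\<lambda>p. coeff p m"] show ?thesis
    using assms by (simp add: coeff_sum)
qed (simp add: gap_vandermonde_eq_0)

lemma det_vandermonde:
  fixes x :: "nat \<Rightarrow> 'a::idom"
  shows "det (mat L L (\<lambda>(i, j). x i ^ j)) = (\<Prod>j<L. \<Prod>i<j. x j - x i)"
proof (induction L)
  case (Suc L)
  let ?V = "gap_vandermonde L L x" and ?q = "\<Prod>i<L. [:x i, 1:]"
  have "det (mat (Suc L) (Suc L) (\<lambda>(i, j). x i ^ j)) =
      (-1) ^ L * (\<Sum>m\<le>L. (- x L) ^ m * (?V * coeff ?q m))"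
    unfolding det_vandermonde_laplace
    by (intro arg_cong2[where f = "(*)"] sum.cong refl gap_vandermonde_eq_coeff) simp
  also have "\<dots> = (-1) ^ L * (?V * poly ?q (- x L))"
    by (simp add: poly_altdef degree_prod_linear sum_distrib_left mult_ac)
  also have "poly ?q (- x L) = (\<Prod>i<L. - (x L - x i))"
    by (simp add: poly_prod)
  also have "\<dots> = (-1) ^ L * (\<Prod>i<L. x L - x i)"
    by (subst prod_uminus) simp
  finally show ?case
    by (simp add: Suc.IH gap_vandermonde_last mult_ac flip: power_mult_distrib)
qed simp

lemma ex_gap_if_not_lessThan:
  fixes U :: "nat set"
  assumes "finite U" "U \<notin> range lessThan"
  shows "\<exists>j. j \<notin> U \<and> Suc j \<in> U"
proof (rule ccontr)
  assume "\<nexists>j. j \<notin> U \<and> Suc j \<in> U"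
  then have down: "j \<in> U" if "Suc j \<in> U" for j
    using that by blast
  define k where "k = (LEAST k. k \<notin> U)"
  have "k \<notin> U"
    unfolding k_def using ex_new_if_finite[OF infinite_UNIV_nat assms(1)] by (rule LeastI_ex)
  have "j \<notin> U" if "k \<le> j" for j
    using that by (induction rule: nat_induct_at_least) (use \<open>k \<notin> U\<close> down in auto)
  moreover have "j \<in> U" if "j < k" for j
    using that not_less_Least unfolding k_def by blast
  ultimately have "U = {..<k}"
    by (auto simp: not_less[symmetric])
  then show False
    using assms(2) by auto
qed

text \<open>Expanding every column \<open>c j x\<^sup>j + x\<^bsup>j + 1\<^esup>\<close>, only those choices survive that pick the first
  summand on an initial segment: otherwise two adjacent columns coincide.\<close>

lemma det_shifted_powers:
  fixes x c :: "nat \<Rightarrow> 'a::comm_ring_1"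
  shows "det (mat L L (\<lambda>(i, j). (c j + x i) * x i ^ j)) =
    (\<Sum>m\<le>L. (\<Prod>j<m. c j) * gap_vandermonde L m x)"
proof -
  let ?A = "mat L L (\<lambda>(i, j). (c j + x i) * x i ^ j)"
  define D where "D U = det_on {..<L} (override_on (\<lambda>j i. x i ^ Suc j) (\<lambda>j i. x i ^ j) U)" for U
  have vanish: "D U = 0" if "U \<in> Pow {..<L} - lessThan ` {..L}" for U
  proof -
    have "U \<noteq> {..<k}" for k
      using that by (cases "k \<le> L") auto
    moreover have "finite U"
      using that finite_subset by auto
    ultimately obtain j where "j \<notin> U" "Suc j \<in> U"
      using ex_gap_if_not_lessThan by blast
    then show ?thesis
      unfolding D_def using that by (intro det_on_identical_rows[of _ j "Suc j"]) auto
  qed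
  have "det ?A = det (transpose_mat ?A)"
    by (rule det_transpose[of _ L, symmetric]) simp
  also have "\<dots> = det_on {..<L} (\<lambda>j i. c j * x i ^ j + x i ^ Suc j)"
    by (subst det_eq_det_on[of _ L]) (auto intro!: det_on_cong simp: algebra_simps)
  also have "\<dots> = (\<Sum>U\<in>Pow {..<L}. (\<Prod>j\<in>U. c j) * D U)"
    unfolding det_on_add[OF finite_lessThan] D_def
    by (intro sum.cong refl) (simp add: det_on_scale_overridden_rows)
  also have "\<dots> = (\<Sum>U\<in>lessThan ` {..L}. (\<Prod>j\<in>U. c j) * D U)"
    by (rule sum.mono_neutral_right) (auto simp: vanish)
  also have "\<dots> = (\<Sum>m\<le>L. (\<Prod>j<m. c j) * gap_vandermonde L m x)"
    by (subst sum.reindex) (auto simp: inj_on_def D_def gap_vandermonde_eq_det_on)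
  finally show ?thesis .
qed

section \<open>The function J as a gamma integral\<close>

text \<open>\<open>gamma_functional a p\<close> is the integral of \<open>s\<^sup>a p(s) exp (- s)\<close> over \<open>s \<ge> 0\<close>.\<close>

definition gamma_functional :: "nat \<Rightarrow> 'a poly \<Rightarrow> 'a::{comm_semiring_1, semiring_char_0}" where
  "gamma_functional a p = (\<Sum>m\<le>degree p. fact (a + m) * coeff p m)"

lemma gamma_functional_eq_sum:
  assumes "degree p \<le> d"
  shows "gamma_functional a p = (\<Sum>m\<le>d. fact (a + m) * coeff p m)"
  unfolding gamma_functional_def
  by (rule sum.mono_neutral_left) (use assms in \<open>auto simp: coeff_eq_0\<close>)

lemma gamma_functional_0 [simp]: "gamma_functional a 0 = 0"
  by (simp add: gamma_functional_def)

lemma gamma_functional_add: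
  "gamma_functional a (p + q) = gamma_functional a p + gamma_functional a q"
proof -
  let ?d = "max (degree p) (degree q)"
  have "degree (p + q) \<le> ?d" "degree p \<le> ?d" "degree q \<le> ?d"
    by (auto intro: degree_add_le)
  then show ?thesis
    by (simp add: gamma_functional_eq_sum[of _ ?d] sum.distrib algebra_simps)
qed

lemma gamma_functional_sum: "gamma_functional a (\<Sum>i\<in>I. p i) = (\<Sum>i\<in>I. gamma_functional a (p i))"
  by (induction I rule: infinite_finite_induct) (simp_all add: gamma_functional_add)

lemma gamma_functional_smult: "gamma_functional a (Polynomial.smult c p) = c * gamma_functional a p"
  by (subst (1 2) gamma_functional_eq_sum[where d = "degree p"])
     (simp_all add: degree_smult_le sum_distrib_left mult_ac)

lemma gamma_functional_pCons:
  "gamma_functional a (pCons c p) = fact a * c + gamma_functional (Suc a) p"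
  by (simp add: gamma_functional_eq_sum[OF degree_pCons_le] gamma_functional_def
      sum.atMost_Suc_shift del: sum.atMost_Suc)

lemma gamma_functional_monom: "gamma_functional a (monom c k) = fact (a + k) * c"
  by (induction k arbitrary: a) (simp_all add: monom_0 monom_Suc gamma_functional_pCons)

lemma gamma_functional_monom_mult: "gamma_functional a (monom 1 k * p) = gamma_functional (a + k) p"
  by (induction k arbitrary: a)
     (simp_all add: monom_0 monom_Suc gamma_functional_pCons flip: one_pCons)

lemma gamma_functional_linear_mult:
  "gamma_functional a ([:x, 1:] * p) = x * gamma_functional a p + gamma_functional (Suc a) p"
  by (simp add: gamma_functional_add gamma_functional_smult gamma_functional_pCons)

lemma tendsto_gamma_functional_prod_list:
  fixes f :: "'b \<Rightarrow> 'c \<Rightarrow> 'a::real_normed_field"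
  assumes "\<And>y. y \<in> set ys \<Longrightarrow> (f y \<longlongrightarrow> l y) F"
  shows "((\<lambda>s. gamma_functional a (\<Prod>y\<leftarrow>ys. [:f y s, 1:])) \<longlongrightarrow>
    gamma_functional a (\<Prod>y\<leftarrow>ys. [:l y, 1:])) F"
  using assms
  by (induction ys arbitrary: a)
     (simp_all add: gamma_functional_linear_mult tendsto_intros del: mult_pCons_left)

lemma J_raw_eq_gamma_functional:
  assumes "distinct ths" "length ths \<le> n"
  shows "J_raw (int n) ths =
    gamma_functional (n - length ths) (\<Prod>x\<leftarrow>ths. [:x, 1:]) / fact (n - length ths)"
proof -
  define L where "L = length ths"
  define x where "x i = ths ! i" for i
  define c :: "nat \<Rightarrow> complex" where "c j = of_nat (n - L + (j + 1))" for j
  define q where "q = (\<Prod>i<L. [:x i, 1:])"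
  let ?V = "\<Prod>j<L. \<Prod>i<j. x j - x i"
  have "inj_on x {..<L}"
    using assms by (auto simp: inj_on_def x_def L_def nth_eq_iff_index_eq)
  then have V: "?V \<noteq> 0"
    by (fastforce dest: inj_onD)
  have prod_c: "(\<Prod>j<m. c j) = fact (n - L + m) / fact (n - L)" for m
    by (induction m) (auto simp: c_def field_simps)
  have degree_q: "degree q = L"
    unfolding q_def by (rule degree_prod_linear)
  have "J_raw (int n) ths = det (mat L L (\<lambda>(i, j). (c j + x i) * x i ^ j)) / ?V"
    using assms
    by (simp add: J_raw_def Let_def L_def[symmetric] x_def c_def of_nat_diff algebra_simps)
  also have "\<dots> = (\<Sum>m\<le>L. (\<Prod>j<m. c j) * (?V * coeff q m)) / ?V"
    unfolding det_shifted_powers q_def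
    by (intro arg_cong2[where f = "(/)"] arg_cong2[where f = "(*)"] sum.cong refl)
       (simp add: gap_vandermonde_eq_coeff[of _ L x] gap_vandermonde_last det_vandermonde)
  also have "\<dots> = (\<Sum>m\<le>L. (\<Prod>j<m. c j) * coeff q m)"
    using V by (simp add: sum_divide_distrib)
  also have "\<dots> = gamma_functional (n - L) q / fact (n - L)"
    unfolding gamma_functional_def degree_q prod_c by (simp add: sum_divide_distrib)
  also have "q = (\<Prod>x\<leftarrow>ths. [:x, 1:])"
    by (simp add: prod.list_conv_set_nth q_def x_def L_def lessThan_atLeast0)
  finally show ?thesis
    by (simp add: L_def)
qed

lemma eventually_distinct_perturbation:
  fixes xs :: "'a::real_normed_field list"
  shows "\<forall>\<^sub>F s in at 0. distinct (map (\<lambda>(i, x). x + s * of_nat i) (List.enumerate 0 xs))"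
proof -
  have "\<forall>\<^sub>F s in at 0. xs ! i + s * of_nat i \<noteq> xs ! k + s * of_nat k" if "i \<noteq> k" for i k
  proof -
    have "\<forall>\<^sub>F s in at 0. s \<noteq> (xs ! k - xs ! i) / (of_nat i - of_nat k)"
      by (rule eventually_neq_at_within)
    then show ?thesis
      by eventually_elim (use that in \<open>auto simp: field_simps\<close>)
  qed
  then have "\<forall>\<^sub>F s in at 0. \<forall>i\<in>{..<length xs}. \<forall>k\<in>{..<length xs} - {i}.
      xs ! i + s * of_nat i \<noteq> xs ! k + s * of_nat k"
    by (intro eventually_ball_finite ballI) auto
  then show ?thesis
    by eventually_elim (auto simp: distinct_conv_nth nth_enumerate_eq)
qed

lemma J_eq_gamma_functional:
  assumes "length ths \<le> n"
  shows "J (int n) ths =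
    gamma_functional (n - length ths) (\<Prod>x\<leftarrow>ths. [:x, 1:]) / fact (n - length ths)"
proof -
  define pert where "pert s = map (\<lambda>(i, x). x + s * of_nat i) (List.enumerate 0 ths)"
    for s :: complex
  define \<Lambda> where
    "\<Lambda> xs = gamma_functional (n - length ths) (\<Prod>x\<leftarrow>xs. [:x, 1:]) / fact (n - length ths)"
    for xs :: "complex list"
  have "\<forall>\<^sub>F s in at 0. distinct (pert s)"
    unfolding pert_def by (rule eventually_distinct_perturbation)
  then have "\<forall>\<^sub>F s in at 0. \<Lambda> (pert s) = J_raw (int n) (pert s)"
  proof eventually_elim
    case (elim s)
    from J_raw_eq_gamma_functional[OF this, of n] assms show ?case
      by (simp add: \<Lambda>_def pert_def)
  qed
  moreover have "((\<lambda>s. \<Lambda> (pert s)) \<longlongrightarrow> \<Lambda> ths) (at 0)"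
  proof -
    let ?f = "\<lambda>y s. case y of (i, x) \<Rightarrow> x + s * of_nat i"
    have "(?f y \<longlongrightarrow> snd y) (at 0)" for y :: "nat \<times> complex"
      by (cases y) (auto intro!: tendsto_eq_intros)
    then have "((\<lambda>s. \<Lambda> (map (\<lambda>y. ?f y s) (List.enumerate 0 ths))) \<longlongrightarrow>
        \<Lambda> (map snd (List.enumerate 0 ths))) (at 0)"
      unfolding \<Lambda>_def map_map o_def
      by (intro tendsto_divide tendsto_gamma_functional_prod_list tendsto_const) auto
    then show ?thesis
      by (simp add: pert_def)
  qed
  ultimately have "((\<lambda>s. J_raw (int n) (pert s)) \<longlongrightarrow> \<Lambda> ths) (at 0)"
    by (rule Lim_transform_eventually[rotated])
  then show ?thesis
    unfolding J_def pert_def[symmetric] \<Lambda>_def[symmetric] by (intro tendsto_Lim) auto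
qed

section \<open>Eigenvalues and determinantal pencils\<close>

lemma length_eigvals:
  assumes "A \<in> carrier_mat n n"
  shows "length (eigvals A) = n"
  and char_poly_eq_prod_eigvals: "char_poly A = (\<Prod>a\<leftarrow>eigvals A. [:- a, 1:])"
proof -
  have "\<exists>as. length as = dim_row A \<and> char_poly A = (\<Prod>a\<leftarrow>as. [:- a, 1:])"
    using char_poly_factorized[OF assms] assms by auto
  from someI_ex[OF this] show "length (eigvals A) = n" "char_poly A = (\<Prod>a\<leftarrow>eigvals A. [:- a, 1:])"
    using assms by (auto simp: eigvals_def)
qed

lemma eigenvalue_if_mem_eigvals:
  assumes "A \<in> carrier_mat n n" "a \<in> set (eigvals A)"
  shows "eigenvalue A a"
  using assms(2)
  by (simp add: eigenvalue_root_char_poly[OF assms(1)] char_poly_eq_prod_eigvals[OF assms(1)]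
      poly_prod_list prod_list_zero_iff image_iff)

lemma det_add_scalar_eq_prod_eigvals:
  assumes "A \<in> carrier_mat n n"
  shows "det (A + y \<cdot>\<^sub>m 1\<^sub>m n) = (\<Prod>a\<leftarrow>eigvals A. y + a)"
proof -
  let ?M = "A + y \<cdot>\<^sub>m 1\<^sub>m n"
  have "(\<Prod>a\<leftarrow>as. - a - y) = (-1) ^ length as * (\<Prod>a\<leftarrow>as. y + a)" for as :: "complex list"
    by (induction as) (auto simp: algebra_simps)
  then have "(-1) ^ n * (\<Prod>a\<leftarrow>eigvals A. y + a) = poly (char_poly A) (- y)"
    using length_eigvals[OF assms] char_poly_eq_prod_eigvals[OF assms]
    by (simp add: poly_prod_list o_def)
  also have "\<dots> = det (- ?M)"
    using char_poly_matrix[OF assms, of "- y"] assms by (simp add: char_matrix_def)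
  also have "- ?M = (-1) \<cdot>\<^sub>m ?M"
    by (rule eq_matI) (use assms in auto)
  also have "det \<dots> = (-1) ^ n * det ?M"
    using assms by simp
  finally show ?thesis
    by simp
qed

lemma minv_carrier:
  assumes A: "A \<in> carrier_mat n n" and nonsing: "det A \<noteq> 0"
  shows "minv A \<in> carrier_mat n n"
  and mult_minv: "A * minv A = 1\<^sub>m n"
proof -
  obtain B where "mat_inverse A = Some B"
    using mat_inverse(1)[OF A] det_non_zero_imp_unit[OF A nonsing] by fastforce
  with mat_inverse(2)[OF A this] show "minv A \<in> carrier_mat n n" "A * minv A = 1\<^sub>m n"
    by (auto simp: minv_def)
qed

lemma det_pencil_eq_prod_eigvals:
  assumes A: "A \<in> carrier_mat n n" and B: "B \<in> carrier_mat n n" and nonsing: "det A \<noteq> 0"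
  shows "det (B + y \<cdot>\<^sub>m A) = det A * (\<Prod>a\<leftarrow>eigvals (minv A * B). y + a)"
proof -
  note inv = minv_carrier[OF A nonsing] mult_minv[OF A nonsing]
  have "A * (minv A * B) = B"
    using inv A B by (simp add: assoc_mult_mat[symmetric, of _ n n _ n _ n])
  then have "A * (minv A * B + y \<cdot>\<^sub>m 1\<^sub>m n) = B + y \<cdot>\<^sub>m A"
    using inv A B by (simp add: mult_add_distrib_mat[of _ n n _ n] mult_smult_distrib[of _ n n _ n])
  then have "det (B + y \<cdot>\<^sub>m A) = det A * det (minv A * B + y \<cdot>\<^sub>m 1\<^sub>m n)"
    using det_mult[of A n "minv A * B + y \<cdot>\<^sub>m 1\<^sub>m n"] inv A B by simp
  then show ?thesis
    using det_add_scalar_eq_prod_eigvals[of "minv A * B" n y] inv B by simp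
qed

lemma prod_list_linear_filter_nonzero:
  fixes as :: "'a::comm_ring_1 list"
  shows "(\<Prod>a\<leftarrow>as. [:a, 1:]) =
    monom 1 (length as - length (filter (\<lambda>x. x \<noteq> 0) as)) * (\<Prod>a\<leftarrow>filter (\<lambda>x. x \<noteq> 0) as. [:a, 1:])"
proof (induction as)
  case (Cons a as)
  have "length (filter (\<lambda>x. x \<noteq> 0) as) \<le> length as"
    by simp
  then show ?case
    using Cons by (cases "a = 0")
      (auto simp: Suc_diff_le monom_Suc mult.left_commute
        simp del: mult_pCons_left mult_pCons_right, simp add: mult_pCons_left)
qed (simp add: monom_0 one_pCons)

lemma det_on_pencil:
  assumes "finite Q"
  shows "det_on Q (\<lambda>i j. a i j + y * b i j) =
    (\<Sum>U\<in>Pow Q. y ^ (card Q - card U) * det_on Q (override_on b a U))"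
  unfolding det_on_add[OF assms]
proof (intro sum.cong refl)
  fix U assume "U \<in> Pow Q"
  then have U: "finite U" "U \<subseteq> Q"
    using assms finite_subset by auto
  have "det_on Q (override_on (\<lambda>i j. y * b i j) a U) =
      det_on Q (override_on a (\<lambda>i j. y * b i j) (Q - U))"
    by (rule det_on_cong) (simp add: override_on_def)
  also have "\<dots> = y ^ card (Q - U) * det_on Q (override_on a b (Q - U))"
    using assms by (simp add: det_on_scale_overridden_rows)
  also have "det_on Q (override_on a b (Q - U)) = det_on Q (override_on b a U)"
    by (rule det_on_cong) (simp add: override_on_def)
  finally show "det_on Q (override_on (\<lambda>i j. y * b i j) a U) =
      y ^ (card Q - card U) * det_on Q (override_on b a U)"
    using U by (simp add: card_Diff_subset)
qed

lemma det_principal_submat_pencil: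
  assumes "finite Q"
  shows "det (principal_submat B Q + y \<cdot>\<^sub>m principal_submat A Q) =
    det_on Q (\<lambda>i j. B $$ (i, j) + y * A $$ (i, j))"
proof -
  let ?q = "(!) (sorted_list_of_set Q)"
  have "principal_submat B Q + y \<cdot>\<^sub>m principal_submat A Q =
      mat (card Q) (card Q) (\<lambda>(i, j). B $$ (?q i, ?q j) + y * A $$ (?q i, ?q j))"
    by (rule eq_matI) (auto simp: principal_submat_def)
  then show ?thesis
    using det_mat_bij_betw[OF bij_betw_nth_sorted_list_of_set[OF assms]] by simp
qed

definition expected_gram_minor :: "nat \<Rightarrow> complex mat \<Rightarrow> complex mat \<Rightarrow> nat set \<Rightarrow> complex" where
  "expected_gram_minor n \<Psi> \<Sigma> Q =
    (let \<theta>s = nonzero_eigvals (minv (principal_submat \<Psi> Q) * principal_submat \<Sigma> Q); L = length \<theta>s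
     in det (principal_submat \<Psi> Q) * J (int n) \<theta>s *
       complex_of_real (fact (n - L) / fact (n - card Q)))"

lemma sum_expected_gram_minor:
  "(\<Sum>Q\<in>{Q. Q \<subseteq> S \<and> card Q = t}. expected_gram_minor n \<Psi> \<Sigma> Q) =
    (\<Sum>Q\<in>{Q. Q \<subseteq> S \<and> card Q = t}.
      let \<theta>s = nonzero_eigvals (minv (principal_submat \<Psi> Q) * principal_submat \<Sigma> Q); L = length \<theta>s
      in det (principal_submat \<Psi> Q) * J (int n) \<theta>s * complex_of_real (fact (n - L) / fact (n - t)))"
  by (intro sum.cong) (auto simp: expected_gram_minor_def)

lemma sum_monom_det_on_eq_prod_eigvals:
  assumes fin: "finite Q" and nonsing: "det (principal_submat \<Psi> Q) \<noteq> 0"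
  shows "(\<Sum>U\<in>Pow Q. monom (det_on Q (override_on (\<lambda>i j. \<Psi> $$ (i, j)) (\<lambda>i j. \<Sigma> $$ (i, j)) U))
      (card Q - card U)) =
    Polynomial.smult (det (principal_submat \<Psi> Q))
      (\<Prod>a\<leftarrow>eigvals (minv (principal_submat \<Psi> Q) * principal_submat \<Sigma> Q). [:a, 1:])"
    (is "?p = ?q")
proof -
  have "poly ?p y = poly ?q y" for y
  proof -
    have "poly ?p y = det_on Q (\<lambda>i j. \<Sigma> $$ (i, j) + y * \<Psi> $$ (i, j))"
      by (simp add: poly_sum poly_monom det_on_pencil[OF fin] mult.commute)
    also have "\<dots> = det (principal_submat \<Sigma> Q + y \<cdot>\<^sub>m principal_submat \<Psi> Q)"
      by (rule det_principal_submat_pencil[OF fin, symmetric])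
    also have "\<dots> = poly ?q y"
      using det_pencil_eq_prod_eigvals[OF principal_submat_carrier principal_submat_carrier nonsing]
      by (simp add: poly_prod_list o_def add.commute)
    finally show ?thesis .
  qed
  then show ?thesis
    by (simp add: poly_eq_poly_eq_iff[symmetric] fun_eq_iff)
qed

lemma sum_det_on_eq_expected_gram_minor:
  assumes fin: "finite Q" and n: "card Q \<le> n" and nonsing: "det (principal_submat \<Psi> Q) \<noteq> 0"
  shows "(\<Sum>U\<in>Pow Q. fact (n - card U) *
      det_on Q (override_on (\<lambda>i j. \<Psi> $$ (i, j)) (\<lambda>i j. \<Sigma> $$ (i, j)) U)) =
    fact (n - card Q) * expected_gram_minor n \<Psi> \<Sigma> Q"
proof -
  define A where "A = minv (principal_submat \<Psi> Q) * principal_submat \<Sigma> Q"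
  define D where "D U = det_on Q (override_on (\<lambda>i j. \<Psi> $$ (i, j)) (\<lambda>i j. \<Sigma> $$ (i, j)) U)" for U
  let ?t = "card Q" and ?L = "length (nonzero_eigvals A)"
  have "A \<in> carrier_mat ?t ?t"
    unfolding A_def
    using minv_carrier[OF principal_submat_carrier nonsing] principal_submat_carrier[of \<Sigma> Q] by simp
  then have len: "length (eigvals A) = ?t"
    by (rule length_eigvals)
  then have L: "?L \<le> ?t"
    unfolding nonzero_eigvals_def by (metis length_filter_le)
  have "(\<Sum>U\<in>Pow Q. fact (n - card U) * D U) =
      gamma_functional (n - ?t) (\<Sum>U\<in>Pow Q. monom (D U) (?t - card U))"
    unfolding gamma_functional_sum gamma_functional_monom
    using n by (intro sum.cong refl) (simp add: card_mono[OF fin])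
  also have "(\<Sum>U\<in>Pow Q. monom (D U) (?t - card U)) =
      Polynomial.smult (det (principal_submat \<Psi> Q)) (\<Prod>a\<leftarrow>eigvals A. [:a, 1:])"
    unfolding D_def A_def by (rule sum_monom_det_on_eq_prod_eigvals[OF fin nonsing])
  also have "(\<Prod>a\<leftarrow>eigvals A. [:a, 1:]) = monom 1 (?t - ?L) * (\<Prod>a\<leftarrow>nonzero_eigvals A. [:a, 1:])"
    using prod_list_linear_filter_nonzero[of "eigvals A"] by (simp add: len nonzero_eigvals_def)
  also have "gamma_functional (n - ?t) (Polynomial.smult (det (principal_submat \<Psi> Q)) \<dots>) =
      det (principal_submat \<Psi> Q) * gamma_functional (n - ?L) (\<Prod>a\<leftarrow>nonzero_eigvals A. [:a, 1:])"
    using n L by (simp add: gamma_functional_smult gamma_functional_monom_mult)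
  also have "gamma_functional (n - ?L) (\<Prod>a\<leftarrow>nonzero_eigvals A. [:a, 1:]) =
      fact (n - ?L) * J (int n) (nonzero_eigvals A)"
    using n L by (simp add: J_eq_gamma_functional)
  finally show ?thesis
    unfolding D_def expected_gram_minor_def A_def[symmetric] by (simp add: Let_def)
qed

section \<open>Positivity of Gram matrices\<close>

lemma ctrans_carrier: "A \<in> carrier_mat n k \<Longrightarrow> ctrans A \<in> carrier_mat k n"
  by (auto simp: ctrans_def)

lemma ctrans_smult: "ctrans (c \<cdot>\<^sub>m A) = cnj c \<cdot>\<^sub>m ctrans A"
  by (rule eq_matI) (auto simp: ctrans_def)

lemma index_ctrans_mult:
  assumes "A \<in> carrier_mat n k" "i < k" "j < k"
  shows "(ctrans A * A) $$ (i, j) = (\<Sum>r<n. cnj (A $$ (r, i)) * A $$ (r, j))"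
  using assms by (auto simp: ctrans_def scalar_prod_def lessThan_atLeast0 intro!: sum.cong)

lemma gram_smult:
  assumes "A \<in> carrier_mat n k"
  shows "ctrans (c \<cdot>\<^sub>m A) * (c \<cdot>\<^sub>m A) = (cnj c * c) \<cdot>\<^sub>m (ctrans A * A)"
  unfolding ctrans_smult using assms ctrans_carrier[OF assms]
  by (intro eq_matI) (auto simp: mult_smult_assoc_mat[of _ k n _ k])

lemma ctrans_mult_vec_cscalar_prod:
  assumes A: "A \<in> carrier_mat n k" and w: "w \<in> carrier_vec n" and v: "v \<in> carrier_vec k"
  shows "(ctrans A *\<^sub>v w) \<bullet>c v = w \<bullet>c (A *\<^sub>v v)"
proof -
  have "(ctrans A *\<^sub>v w) \<bullet>c v = (\<Sum>i<k. \<Sum>r<n. cnj (A $$ (r, i)) * w $ r * cnj (v $ i))"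
    using assms by (simp add: ctrans_def scalar_prod_def sum_distrib_right lessThan_atLeast0)
  also have "\<dots> = (\<Sum>r<n. \<Sum>i<k. cnj (A $$ (r, i)) * w $ r * cnj (v $ i))"
    by (rule sum.swap)
  also have "\<dots> = w \<bullet>c (A *\<^sub>v v)"
    using assms by (simp add: scalar_prod_def sum_distrib_left lessThan_atLeast0 mult_ac)
  finally show ?thesis .
qed

lemma eigenvalue_gram_nonneg:
  assumes A: "A \<in> carrier_mat n k" and "eigenvalue (ctrans A * A) a"
  shows "0 \<le> a"
proof -
  obtain v where v: "v \<in> carrier_vec k" "v \<noteq> 0\<^sub>v k" and eig: "(ctrans A * A) *\<^sub>v v = a \<cdot>\<^sub>v v"
    using assms ctrans_carrier[OF A] by (auto simp: eigenvalue_def eigenvector_def)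
  have "a * (v \<bullet>c v) = (ctrans A *\<^sub>v (A *\<^sub>v v)) \<bullet>c v"
    using eig v by (simp add: assoc_mult_mat_vec[OF ctrans_carrier[OF A] A v(1), symmetric])
  also have "\<dots> = (A *\<^sub>v v) \<bullet>c (A *\<^sub>v v)"
    using A v by (intro ctrans_mult_vec_cscalar_prod) auto
  finally have "a = ((A *\<^sub>v v) \<bullet>c (A *\<^sub>v v)) / (v \<bullet>c v)"
    using v by (simp add: field_simps)
  moreover have "0 \<le> (A *\<^sub>v v) \<bullet>c (A *\<^sub>v v)" "0 \<le> v \<bullet>c v"
    by auto
  ultimately show ?thesis
    by (auto simp: less_eq_complex_def Re_divide Im_divide)
qed

lemma prod_list_add_of_real_ge:
  assumes "0 \<le> y" "\<And>a. a \<in> set as \<Longrightarrow> 0 \<le> a"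
  shows "complex_of_real (y ^ length as) \<le> (\<Prod>a\<leftarrow>as. complex_of_real y + a)"
  using assms(2)
proof (induction as)
  case (Cons a as)
  have "complex_of_real y * complex_of_real (y ^ length as) \<le>
      (complex_of_real y + a) * (\<Prod>a\<leftarrow>as. complex_of_real y + a)"
    using assms(1) Cons by (intro mult_mono) (auto simp: less_eq_complex_def)
  then show ?case
    by simp
qed simp

lemma det_gram_plus_scalar_ge:
  assumes A: "A \<in> carrier_mat n k" and "0 \<le> y"
  shows "complex_of_real (y ^ k) \<le> det (ctrans A * A + complex_of_real y \<cdot>\<^sub>m 1\<^sub>m k)"
proof -
  have carr: "ctrans A * A \<in> carrier_mat k k"
    using A ctrans_carrier[OF A] by simp
  show ?thesis
    using prod_list_add_of_real_ge[OF assms(2), of "eigvals (ctrans A * A)"]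
      eigenvalue_gram_nonneg[OF A eigenvalue_if_mem_eigvals[OF carr]]
    by (simp add: det_add_scalar_eq_prod_eigvals[OF carr] length_eigvals[OF carr])
qed

lemma det_one_plus_mult_commute:
  fixes A B :: "'a::idom mat"
  assumes A: "A \<in> carrier_mat n m" and B: "B \<in> carrier_mat m n"
  shows "det (1\<^sub>m n + A * B) = det (1\<^sub>m m + B * A)"
proof -
  let ?L = "four_block_mat (1\<^sub>m n) (0\<^sub>m n m) B (1\<^sub>m m)"
  let ?R = "four_block_mat (1\<^sub>m n) (- A) (0\<^sub>m m n) (1\<^sub>m m + B * A)"
  let ?R' = "four_block_mat (1\<^sub>m n + A * B) (- A) (0\<^sub>m m n) (1\<^sub>m m)"
  let ?X = "four_block_mat (1\<^sub>m n) (- A) B (1\<^sub>m m)"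
  have "?L * ?R = ?X"
    by (subst mult_four_block_mat[of _ n n _ m _ m _ _ n _ m]) (use A B in auto)
  moreover have "?R' * ?L = ?X"
    by (subst mult_four_block_mat[of _ n n _ m _ m _ _ n _ m]) (use A B in auto)
  moreover have "det (?L * ?R) = det ?L * det ?R" "det (?R' * ?L) = det ?R' * det ?L"
    by (rule det_mult[of _ "n + m"], use A B in auto)+
  moreover have "det ?L = 1"
    by (subst det_four_block_mat_upper_right_zero[of _ n _ m]) (use A B in auto)
  moreover have "det ?R = det (1\<^sub>m m + B * A)"
    by (subst det_four_block_mat_lower_left_zero[of _ n _ m]) (use A B in auto)
  moreover have "det ?R' = det (1\<^sub>m n + A * B)"
    by (subst det_four_block_mat_lower_left_zero[of _ n _ m]) (use A B in auto)
  ultimately show ?thesis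
    by simp
qed

lemma det_one_plus_gram_commute:
  assumes A: "A \<in> carrier_mat n k"
  shows "det (1\<^sub>m n + c \<cdot>\<^sub>m (A * ctrans A)) = det (1\<^sub>m k + c \<cdot>\<^sub>m (ctrans A * A))"
proof -
  note A' = ctrans_carrier[OF A]
  have "c \<cdot>\<^sub>m (A * ctrans A) = (c \<cdot>\<^sub>m A) * ctrans A"
    using A A' by (simp add: mult_smult_assoc_mat[of _ n k])
  moreover have "c \<cdot>\<^sub>m (ctrans A * A) = ctrans A * (c \<cdot>\<^sub>m A)"
    using A A' by (simp add: mult_smult_distrib[of _ k n _ k])
  ultimately show ?thesis
    using det_one_plus_mult_commute[of "c \<cdot>\<^sub>m A" n k "ctrans A"] A A' by simp
qed

lemma det_one_plus_gram_eq_sum_minors: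
  assumes A: "A \<in> carrier_mat n k"
  shows "det (1\<^sub>m n + c \<cdot>\<^sub>m (A * ctrans A)) =
    (\<Sum>Q\<in>Pow {..<k}. c ^ card Q * det_on Q (\<lambda>i j. \<Sum>r<n. cnj (A $$ (r, i)) * A $$ (r, j)))"
proof -
  have "det (1\<^sub>m n + c \<cdot>\<^sub>m (A * ctrans A)) =
      det_on {..<k} (\<lambda>i j. (if i = j then 1 else 0) + c * (\<Sum>r<n. cnj (A $$ (r, i)) * A $$ (r, j)))"
    unfolding det_one_plus_gram_commute[OF A]
    using A ctrans_carrier[OF A] by (subst det_eq_det_on[of _ k])
      (auto intro!: det_on_cong simp: index_ctrans_mult[OF A] simp del: index_mult_mat(1))
  then show ?thesis
    by (simp add: det_on_identity_plus)
qed

lemma Re_det_one_plus_gram_ge_1: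
  assumes A: "A \<in> carrier_mat n k" and "0 \<le> c"
  shows "1 \<le> Re (det (1\<^sub>m n + complex_of_real c \<cdot>\<^sub>m (A * ctrans A)))"
proof -
  let ?B = "complex_of_real (sqrt c) \<cdot>\<^sub>m A"
  have B: "?B \<in> carrier_mat n k"
    using A by simp
  have "complex_of_real c \<cdot>\<^sub>m (ctrans A * A) = ctrans ?B * ?B"
    using assms(2) by (simp add: gram_smult[OF A] flip: of_real_mult)
  then have "det (1\<^sub>m n + complex_of_real c \<cdot>\<^sub>m (A * ctrans A)) = det (ctrans ?B * ?B + 1\<^sub>m k)"
    unfolding det_one_plus_gram_commute[OF A]
    using B ctrans_carrier[OF B] by (simp add: comm_add_mat[of "1\<^sub>m k" k k])
  also have "1\<^sub>m k = complex_of_real 1 \<cdot>\<^sub>m 1\<^sub>m k"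
    by (rule eq_matI) auto
  also have "1 \<le> det (ctrans ?B * ?B + complex_of_real 1 \<cdot>\<^sub>m 1\<^sub>m k)"
    using det_gram_plus_scalar_ge[OF B, of 1] by simp
  finally show ?thesis
    by (simp add: less_eq_complex_def)
qed

lemma det_principal_submat_gram_plus_scalar_nonzero:
  assumes F: "F \<in> carrier_mat m k" and "0 < d" and Q: "Q \<subseteq> {..<k}"
  shows "det (principal_submat (ctrans F * F + complex_of_real d \<cdot>\<^sub>m 1\<^sub>m k) Q) \<noteq> 0"
proof -
  let ?q = "(!) (sorted_list_of_set Q)" and ?t = "card Q"
  define E where "E = mat m ?t (\<lambda>(r, i). F $$ (r, ?q i))"
  have E: "E \<in> carrier_mat m ?t"
    by (simp add: E_def)
  have "finite Q"
    using Q finite_subset by auto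
  then have bij: "bij_betw ?q {..<?t} Q"
    by (rule bij_betw_nth_sorted_list_of_set)
  have "principal_submat (ctrans F * F + complex_of_real d \<cdot>\<^sub>m 1\<^sub>m k) Q =
      ctrans E * E + complex_of_real d \<cdot>\<^sub>m 1\<^sub>m ?t"
  proof (rule eq_matI)
    fix i j assume "i < dim_row (ctrans E * E + complex_of_real d \<cdot>\<^sub>m 1\<^sub>m ?t)"
      and "j < dim_col (ctrans E * E + complex_of_real d \<cdot>\<^sub>m 1\<^sub>m ?t)"
    then have ij: "i < ?t" "j < ?t"
      by auto
    then have "?q i < k" "?q j < k" "?q i = ?q j \<longleftrightarrow> i = j"
      using bij Q by (auto simp: bij_betw_def inj_on_def)
    moreover have "(ctrans E * E) $$ (i, j) = (\<Sum>r<m. cnj (F $$ (r, ?q i)) * F $$ (r, ?q j))"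
      unfolding index_ctrans_mult[OF E ij] using ij by (simp add: E_def)
    ultimately show "principal_submat (ctrans F * F + complex_of_real d \<cdot>\<^sub>m 1\<^sub>m k) Q $$ (i, j) =
        (ctrans E * E + complex_of_real d \<cdot>\<^sub>m 1\<^sub>m ?t) $$ (i, j)"
      using ij F E ctrans_carrier[OF F] ctrans_carrier[OF E]
      by (simp add: principal_submat_def index_ctrans_mult[OF F] del: index_mult_mat(1))
  qed (use E in \<open>auto simp: principal_submat_def ctrans_def\<close>)
  moreover have "complex_of_real (d ^ ?t) \<le> det (ctrans E * E + complex_of_real d \<cdot>\<^sub>m 1\<^sub>m ?t)"
    using det_gram_plus_scalar_ge[OF E] assms(2) by simp
  moreover have "0 < d ^ ?t"
    using assms(2) by simp
  ultimately show ?thesis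
    by (auto simp: less_eq_complex_def)
qed

section \<open>Products of independent random variables\<close>

lemma has_bochner_integral_distrD:
  fixes f :: "'b \<Rightarrow> 'c::{banach, second_countable_topology}"
  assumes "has_bochner_integral (distr M N T) f c" "T \<in> M \<rightarrow>\<^sub>M N"
  shows "has_bochner_integral M (\<lambda>x. f (T x)) c"
proof -
  have "f \<in> borel_measurable N"
    using borel_measurable_has_bochner_integral[OF assms(1)] by simp
  then show ?thesis
    using assms by (auto simp: has_bochner_integral_iff integral_distr intro: integrable_distr)
qed

lemma has_bochner_integral_cnj:
  "has_bochner_integral M f c \<Longrightarrow> has_bochner_integral M (\<lambda>x. cnj (f x)) (cnj c)"
  by (simp add: has_bochner_integral_iff)

lemma borel_measurable_cnj [measurable]: "cnj \<in> borel_measurable borel"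
  by (intro borel_measurable_continuous_onI continuous_intros)

context prob_space
begin

lemma sets_Collect_Ball_indep_vars:
  assumes "indep_vars M' X I" "S \<subseteq> I" "finite S" "\<And>i. i \<in> S \<Longrightarrow> A i \<in> sets (M' i)"
  shows "{\<omega>\<in>space M. \<forall>i\<in>S. X i \<omega> \<in> A i} \<in> events"
proof (rule sets.sets_Collect_finite_All)
  fix i assume "i \<in> S"
  then have "X i -` A i \<inter> space M \<in> events"
    using assms by (auto simp: indep_vars_def intro!: measurable_sets)
  then show "{\<omega>\<in>space M. X i \<omega> \<in> A i} \<in> events"
    by (simp add: vimage_def Int_def conj_commute)
qed fact

lemma indep_vars_prob_Ball:
  assumes "indep_vars M' X I" "S \<subseteq> I" "finite S" "\<And>i. i \<in> S \<Longrightarrow> A i \<in> sets (M' i)"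
  shows "prob {\<omega>\<in>space M. \<forall>i\<in>S. X i \<omega> \<in> A i} = (\<Prod>i\<in>S. prob {\<omega>\<in>space M. X i \<omega> \<in> A i})"
proof (cases "S = {}")
  case False
  have "(\<Inter>i\<in>S. X i -` A i \<inter> space M) = {\<omega>\<in>space M. \<forall>i\<in>S. X i \<omega> \<in> A i}"
    using False by auto
  moreover have "X i -` A i \<inter> space M = {\<omega>\<in>space M. X i \<omega> \<in> A i}" for i
    by auto
  ultimately show ?thesis
    using indep_varsD[OF assms(1) False assms(3,2,4)] by simp
qed (simp add: prob_space)

lemma indep_varsI:
  assumes rv: "\<And>i. i \<in> I \<Longrightarrow> random_variable (M' i) (X i)"
    and prob: "\<And>S A. finite S \<Longrightarrow> S \<subseteq> I \<Longrightarrow> (\<And>i. i \<in> S \<Longrightarrow> A i \<in> sets (M' i)) \<Longrightarrow>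
      prob {\<omega>\<in>space M. \<forall>i\<in>S. X i \<omega> \<in> A i} = (\<Prod>i\<in>S. prob {\<omega>\<in>space M. X i \<omega> \<in> A i})"
  shows "indep_vars M' X I"
proof -
  have vimage: "X i -` A \<inter> space M = {\<omega>\<in>space M. X i \<omega> \<in> A}" for i A
    by auto
  have "indep_sets (\<lambda>i. {{\<omega>\<in>space M. X i \<omega> \<in> A} |A. A \<in> sets (M' i)}) I"
  proof (rule indep_setsI)
    fix i assume "i \<in> I"
    then show "{{\<omega>\<in>space M. X i \<omega> \<in> A} |A. A \<in> sets (M' i)} \<subseteq> events"
      using measurable_sets[OF rv] by (auto simp: vimage)
  next
    fix E S assume S: "S \<noteq> {}" "S \<subseteq> I" "finite S"
      and "\<forall>i\<in>S. E i \<in> {{\<omega>\<in>space M. X i \<omega> \<in> A} |A. A \<in> sets (M' i)}"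
    then have "\<forall>i\<in>S. \<exists>A. E i = {\<omega>\<in>space M. X i \<omega> \<in> A} \<and> A \<in> sets (M' i)"
      by simp
    from bchoice[OF this] obtain A where E: "\<And>i. i \<in> S \<Longrightarrow> E i = {\<omega>\<in>space M. X i \<omega> \<in> A i}"
      and A: "\<And>i. i \<in> S \<Longrightarrow> A i \<in> sets (M' i)"
      by blast
    have "(\<Inter>i\<in>S. E i) = {\<omega>\<in>space M. \<forall>i\<in>S. X i \<omega> \<in> A i}"
      using S(1) E by auto
    then show "prob (\<Inter>i\<in>S. E i) = (\<Prod>i\<in>S. prob (E i))"
      using prob[OF S(3,2) A] E by simp
  qed
  then show ?thesis
    using rv by (simp add: indep_vars_def2 vimage)
qed

lemma indep_vars_reindex:
  assumes "indep_vars M' X I" "inj_on f S" "f ` S \<subseteq> I"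
  shows "indep_vars (\<lambda>j. M' (f j)) (\<lambda>j. X (f j)) S"
proof -
  have "indep_vars (\<lambda>j. PiM {f j} M') (\<lambda>j \<omega>. restrict (\<lambda>i. X i \<omega>) {f j}) S"
    by (rule indep_vars_restrict[OF assms(1)])
       (use assms(2,3) in \<open>auto simp: disjoint_family_on_def inj_on_def\<close>)
  then have "indep_vars (\<lambda>j. M' (f j)) (\<lambda>j \<omega>. restrict (\<lambda>i. X i \<omega>) {f j} (f j)) S"
    by (rule indep_vars_compose2) simp
  then show ?thesis
    by simp
qed

lemma has_bochner_integral_prod_indep:
  fixes X :: "'i \<Rightarrow> 'a \<Rightarrow> 'b::{real_normed_field, banach, second_countable_topology}"
  assumes "finite I" "indep_vars (\<lambda>_. borel) X I"
    and "\<And>i. i \<in> I \<Longrightarrow> has_bochner_integral M (X i) (m i)"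
  shows "has_bochner_integral M (\<lambda>\<omega>. \<Prod>i\<in>I. X i \<omega>) (\<Prod>i\<in>I. m i)"
  using indep_vars_integrable[OF assms(1,2)] indep_vars_lebesgue_integral[OF assms(1,2)] assms(3)
  by (simp add: has_bochner_integral_iff)

end

lemma indep_vars_PiM_component:
  assumes "\<And>i. i \<in> I \<Longrightarrow> prob_space (M i)"
  shows "prob_space.indep_vars (PiM I M) M (\<lambda>i w. w i) I"
proof -
  interpret P: prob_space "PiM I M"
    by (rule prob_space_PiM) (rule assms)
  show ?thesis
  proof (cases "I = {}")
    case True
    then show ?thesis
      by (intro P.indep_varsI) (auto simp: P.prob_space[unfolded True])
  next
    case False
    have "distr (PiM I M) (PiM I M) (\<lambda>w. \<lambda>i\<in>I. w i) = distr (PiM I M) (PiM I M) (\<lambda>w. w)"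
      by (rule distr_cong) (auto simp: space_PiM PiE_restrict)
    also have "\<dots> = PiM I (\<lambda>i. distr (PiM I M) (M i) (\<lambda>w. w i))"
      using assms by (auto simp: distr_PiM_component intro!: PiM_cong)
    finally show ?thesis
      using False by (subst P.indep_vars_iff_distr_eq_PiM') auto
  qed
qed

lemma has_bochner_integral_PiM_component:
  fixes f :: "'a \<Rightarrow> 'c::{banach, second_countable_topology}"
  assumes "\<And>i. i \<in> I \<Longrightarrow> prob_space (M i)" "i \<in> I" "has_bochner_integral (M i) f c"
  shows "has_bochner_integral (PiM I M) (\<lambda>w. f (w i)) c"
  by (rule has_bochner_integral_distrD[where N = "M i"])
     (use assms in \<open>simp_all add: distr_PiM_component\<close>)

context pair_prob_space
begin

lemma distr_snd: "distr (M1 \<Otimes>\<^sub>M M2) M2 snd = M2"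
proof (intro measure_eqI)
  fix A assume A: "A \<in> sets (distr (M1 \<Otimes>\<^sub>M M2) M2 snd)"
  then have "emeasure (distr (M1 \<Otimes>\<^sub>M M2) M2 snd) A = emeasure (M1 \<Otimes>\<^sub>M M2) (space M1 \<times> A)"
    by (auto simp: emeasure_distr space_pair_measure dest: sets.sets_into_space
        intro!: arg_cong2[where f = emeasure])
  with A show "emeasure (distr (M1 \<Otimes>\<^sub>M M2) M2 snd) A = emeasure M2 A"
    by (simp add: M2.emeasure_pair_measure_Times M1.emeasure_space_1)
qed simp

lemma has_bochner_integral_fst:
  fixes f :: "'a \<Rightarrow> 'c::{banach, second_countable_topology}"
  assumes "has_bochner_integral M1 f c"
  shows "has_bochner_integral (M1 \<Otimes>\<^sub>M M2) (\<lambda>w. f (fst w)) c"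
  by (rule has_bochner_integral_distrD[OF _ measurable_fst]) (simp add: M2.distr_pair_fst assms)

lemma has_bochner_integral_snd:
  fixes f :: "'b \<Rightarrow> 'c::{banach, second_countable_topology}"
  assumes "has_bochner_integral M2 f c"
  shows "has_bochner_integral (M1 \<Otimes>\<^sub>M M2) (\<lambda>w. f (snd w)) c"
  by (rule has_bochner_integral_distrD[OF _ measurable_snd]) (simp add: distr_snd assms)

lemma prob_Times:
  assumes "A \<in> sets M1" "B \<in> sets M2"
  shows "P.prob (A \<times> B) = M1.prob A * M2.prob B"
  using assms by (simp add: measure_def M2.emeasure_pair_measure_Times enn2real_mult)

lemma prob_Ball_fst_snd:
  assumes X: "M1.indep_vars M' X I" and S: "S \<subseteq> I" "finite S" "\<And>i. i \<in> S \<Longrightarrow> A i \<in> sets (M' i)"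
    and Y: "M2.indep_vars N' Y K" and T: "T \<subseteq> K" "finite T" "\<And>k. k \<in> T \<Longrightarrow> B k \<in> sets (N' k)"
  shows "P.prob {w\<in>space (M1 \<Otimes>\<^sub>M M2). (\<forall>i\<in>S. X i (fst w) \<in> A i) \<and> (\<forall>k\<in>T. Y k (snd w) \<in> B k)} =
    (\<Prod>i\<in>S. M1.prob {u\<in>space M1. X i u \<in> A i}) * (\<Prod>k\<in>T. M2.prob {v\<in>space M2. Y k v \<in> B k})"
proof -
  have "{w\<in>space (M1 \<Otimes>\<^sub>M M2). (\<forall>i\<in>S. X i (fst w) \<in> A i) \<and> (\<forall>k\<in>T. Y k (snd w) \<in> B k)} =
      {u\<in>space M1. \<forall>i\<in>S. X i u \<in> A i} \<times> {v\<in>space M2. \<forall>k\<in>T. Y k v \<in> B k}"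
    by (auto simp: space_pair_measure)
  then show ?thesis
    using M1.sets_Collect_Ball_indep_vars[OF X S] M2.sets_Collect_Ball_indep_vars[OF Y T]
      M1.indep_vars_prob_Ball[OF X S] M2.indep_vars_prob_Ball[OF Y T]
    by (simp add: prob_Times)
qed

lemma indep_vars_Plus:
  assumes X: "M1.indep_vars M' X I" and Y: "M2.indep_vars N' Y K"
  shows "P.indep_vars (case_sum M' N') (case_sum (\<lambda>i w. X i (fst w)) (\<lambda>k w. Y k (snd w))) (I <+> K)"
proof (rule P.indep_varsI)
  let ?P = "M1 \<Otimes>\<^sub>M M2" and ?Z = "case_sum (\<lambda>i w. X i (fst w)) (\<lambda>k w. Y k (snd w))"
  have "X i \<in> M1 \<rightarrow>\<^sub>M M' i" if "i \<in> I" for i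
    using X that by (simp add: M1.indep_vars_def)
  moreover have "Y k \<in> M2 \<rightarrow>\<^sub>M N' k" if "k \<in> K" for k
    using Y that by (simp add: M2.indep_vars_def)
  ultimately show "?Z z \<in> ?P \<rightarrow>\<^sub>M case_sum M' N' z" if "z \<in> I <+> K" for z
    using that
    by (auto intro: measurable_compose[OF measurable_fst] measurable_compose[OF measurable_snd])
  fix S A assume "finite S" "S \<subseteq> I <+> K" and A: "\<And>z. z \<in> S \<Longrightarrow> A z \<in> sets (case_sum M' N' z)"
  define I' K' where "I' = Inl -` S" and "K' = Inr -` S"
  have S_eq: "S = I' <+> K'"
    using \<open>S \<subseteq> I <+> K\<close> by (auto simp: I'_def K'_def Plus_def)
  have I': "I' \<subseteq> I" "finite I'" "\<And>i. i \<in> I' \<Longrightarrow> A (Inl i) \<in> sets (M' i)"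
    and K': "K' \<subseteq> K" "finite K'" "\<And>k. k \<in> K' \<Longrightarrow> A (Inr k) \<in> sets (N' k)"
    using \<open>finite S\<close> \<open>S \<subseteq> I <+> K\<close> A[of "Inl _"] A[of "Inr _"]
    by (auto simp: I'_def K'_def finite_vimageI)
  have "P.prob {w\<in>space ?P. \<forall>z\<in>S. ?Z z w \<in> A z} =
      (\<Prod>i\<in>I'. M1.prob {u\<in>space M1. X i u \<in> A (Inl i)}) *
      (\<Prod>k\<in>K'. M2.prob {v\<in>space M2. Y k v \<in> A (Inr k)})"
    using prob_Ball_fst_snd[OF X I' Y K'] by (simp add: S_eq Plus_def ball_Un)
  also have "\<dots> = (\<Prod>i\<in>I'. P.prob {w\<in>space ?P. ?Z (Inl i) w \<in> A (Inl i)}) *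
      (\<Prod>k\<in>K'. P.prob {w\<in>space ?P. ?Z (Inr k) w \<in> A (Inr k)})"
  proof (intro arg_cong2[where f = "(*)"] prod.cong refl)
    fix i assume "i \<in> I'"
    then show "M1.prob {u\<in>space M1. X i u \<in> A (Inl i)} =
        P.prob {w\<in>space ?P. ?Z (Inl i) w \<in> A (Inl i)}"
      using prob_Ball_fst_snd[OF X _ _ _ Y, where S = "{i}" and A = "\<lambda>i. A (Inl i)" and T = "{}"] I'
      by auto
  next
    fix k assume "k \<in> K'"
    then show "M2.prob {v\<in>space M2. Y k v \<in> A (Inr k)} =
        P.prob {w\<in>space ?P. ?Z (Inr k) w \<in> A (Inr k)}"
      using prob_Ball_fst_snd[OF X _ _ _ Y, where S = "{}" and T = "{k}" and B = "\<lambda>k. A (Inr k)"] K'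
      by auto
  qed
  also have "\<dots> = (\<Prod>z\<in>S. P.prob {w\<in>space ?P. ?Z z w \<in> A z})"
    unfolding S_eq by (simp add: prod.Plus I'(2) K'(2))
  finally show "P.prob {w\<in>space ?P. \<forall>z\<in>S. ?Z z w \<in> A z} =
      (\<Prod>z\<in>S. P.prob {w\<in>space ?P. ?Z z w \<in> A z})" .
qed

end

section \<open>Gram matrices of random matrices with independent rows\<close>

context prob_space
begin

lemma nn_integral_log_le_log_mean:
  assumes X: "\<And>\<omega>. \<omega> \<in> space M \<Longrightarrow> 1 \<le> X \<omega>" and int: "has_bochner_integral M X m" and b: "1 < b"
  shows "(\<integral>\<^sup>+ \<omega>. ennreal (log b (X \<omega>)) \<partial>M) \<le> ennreal (log b m)"
proof -
  have X_int: "integrable M X" and X_mean: "expectation X = m"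
    using int by (auto simp: has_bochner_integral_iff)
  have "expectation (\<lambda>_. 1) \<le> expectation X"
    using X X_int by (intro integral_mono_AE) auto
  then have m: "1 \<le> m"
    by (simp add: prob_space X_mean)
  \<comment> \<open>the tangent of \<open>log b\<close> at the mean\<close>
  let ?f = "\<lambda>\<omega>. log b m + (X \<omega> / m - 1) / ln b"
  have log_le: "log b (X \<omega>) \<le> ?f \<omega>" if "\<omega> \<in> space M" for \<omega>
  proof -
    have "ln (X \<omega>) - ln m \<le> X \<omega> / m - 1"
      using m X[OF that] ln_le_minus_one[of "X \<omega> / m"] by (simp add: ln_div)
    then have "(ln (X \<omega>) - ln m) / ln b \<le> (X \<omega> / m - 1) / ln b"
      using b by (intro divide_right_mono) auto
    then show ?thesis
      by (simp add: log_def diff_divide_distrib)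
  qed
  have "(\<integral>\<^sup>+ \<omega>. ennreal (log b (X \<omega>)) \<partial>M) \<le> (\<integral>\<^sup>+ \<omega>. ennreal (?f \<omega>) \<partial>M)"
    by (intro nn_integral_mono ennreal_leI log_le)
  also have "\<dots> = ennreal (expectation ?f)"
  proof (rule nn_integral_eq_integral)
    show "integrable M ?f"
      using X_int by auto
    have "0 \<le> ?f \<omega>" if "\<omega> \<in> space M" for \<omega>
      using X[OF that] b log_le[OF that] zero_le_log_cancel_iff[of b "X \<omega>"] by linarith
    then show "AE \<omega> in M. 0 \<le> ?f \<omega>"
      by auto
  qed
  also have "expectation ?f = log b m"
    using X_int X_mean m by (simp add: prob_space)
  finally show ?thesis .
qed

lemma has_bochner_integral_det_on_gram:
  fixes g :: "'r \<Rightarrow> 'i \<Rightarrow> 'a \<Rightarrow> complex"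
  assumes fin: "finite Q" "finite R" and Q: "Q \<subseteq> C"
    and indep: "indep_vars (\<lambda>_. PiM C (\<lambda>_. borel)) (\<lambda>r \<omega>. \<lambda>j\<in>C. g r j \<omega>) R"
    and moment: "\<And>r i j. r \<in> R \<Longrightarrow> i \<in> Q \<Longrightarrow> j \<in> Q \<Longrightarrow>
      has_bochner_integral M (\<lambda>\<omega>. cnj (g r i \<omega>) * g r j \<omega>) (c r i j)"
  shows "has_bochner_integral M (\<lambda>\<omega>. det_on Q (\<lambda>i j. \<Sum>r\<in>R. cnj (g r i \<omega>) * g r j \<omega>))
    (\<Sum>f\<in>inj_PiE Q R. det_on Q (\<lambda>i j. c (f i) i j))"
  unfolding det_on_gram[OF fin] unfolding det_on_def
proof (intro has_bochner_integral_sum has_bochner_integral_mult_right)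
  fix f p assume "f \<in> inj_PiE Q R" "p \<in> {p. p permutes Q}"
  then have f: "inj_on f Q" "f ` Q \<subseteq> R" and p: "\<And>i. i \<in> Q \<Longrightarrow> p i \<in> Q"
    by (auto simp: permutes_in_image)
  have C: "i \<in> C" "p i \<in> C" if "i \<in> Q" for i
    using that p Q by auto
  have "indep_vars (\<lambda>_. PiM C (\<lambda>_. borel)) (\<lambda>i \<omega>. \<lambda>j\<in>C. g (f i) j \<omega>) Q"
    by (rule indep_vars_reindex[OF indep f])
  then have "indep_vars (\<lambda>_. borel)
      (\<lambda>i \<omega>. (\<lambda>v. cnj (v i) * v (p i)) (\<lambda>j\<in>C. g (f i) j \<omega>)) Q"
  proof (rule indep_vars_compose2)
    fix i assume "i \<in> Q"
    from C[OF this] show "(\<lambda>v. cnj (v i) * v (p i)) \<in> borel_measurable (PiM C (\<lambda>_. borel))"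
      by measurable
  qed
  then have "indep_vars (\<lambda>_. borel) (\<lambda>i \<omega>. cnj (g (f i) i \<omega>) * g (f i) (p i) \<omega>) Q"
    by (rule indep_vars_cong[THEN iffD1, rotated -1]) (simp_all add: C)
  then show "has_bochner_integral M (\<lambda>\<omega>. \<Prod>i\<in>Q. cnj (g (f i) i \<omega>) * g (f i) (p i) \<omega>)
      (\<Prod>i\<in>Q. c (f i) i (p i))"
    by (rule has_bochner_integral_prod_indep[OF fin(1)]) (use p f in \<open>auto intro!: moment\<close>)
qed

lemma has_bochner_integral_cnj_mult_indep:
  fixes X :: "'x \<Rightarrow> 'a \<Rightarrow> complex"
  assumes indep: "indep_vars (\<lambda>_. borel) X K" and xy: "x \<in> K" "y \<in> K"
    and mean: "\<And>x. x \<in> K \<Longrightarrow> has_bochner_integral M (X x) 0"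
    and var: "\<And>x. x \<in> K \<Longrightarrow> has_bochner_integral M (\<lambda>\<omega>. cnj (X x \<omega>) * X x \<omega>) 1"
  shows "has_bochner_integral M (\<lambda>\<omega>. cnj (X x \<omega>) * X y \<omega>) (if x = y then 1 else 0)"
proof (cases "x = y")
  case False
  have "indep_vars (\<lambda>_. borel) X {x, y}"
    by (rule indep_vars_subset[OF indep]) (use xy in auto)
  then have "indep_vars (\<lambda>_. borel) (\<lambda>z \<omega>. (if z = x then cnj else id) (X z \<omega>)) {x, y}"
    by (rule indep_vars_compose2) auto
  then have "has_bochner_integral M (\<lambda>\<omega>. \<Prod>z\<in>{x, y}. (if z = x then cnj else id) (X z \<omega>))
      (\<Prod>z\<in>{x, y}. 0)"
    using False has_bochner_integral_cnj[OF mean[OF xy(1)]] mean[OF xy(2)]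
    by (intro has_bochner_integral_prod_indep) auto
  then show ?thesis
    using False by simp
qed (use var xy in auto)

lemma has_bochner_integral_affine_covariance:
  fixes X :: "'x \<Rightarrow> 'a \<Rightarrow> complex" and a b :: "'x \<Rightarrow> complex"
  assumes fin: "finite K"
    and mean: "\<And>x. x \<in> K \<Longrightarrow> has_bochner_integral M (X x) 0"
    and cov: "\<And>x y. x \<in> K \<Longrightarrow> y \<in> K \<Longrightarrow>
      has_bochner_integral M (\<lambda>\<omega>. cnj (X x \<omega>) * X y \<omega>) (if x = y then 1 else 0)"
  shows "has_bochner_integral M
    (\<lambda>\<omega>. cnj (u + (\<Sum>x\<in>K. X x \<omega> * a x)) * (v + (\<Sum>x\<in>K. X x \<omega> * b x)))
    ((\<Sum>x\<in>K. cnj (a x) * b x) + cnj u * v)"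
proof -
  have "has_bochner_integral M (\<lambda>\<omega>.
      (\<Sum>x\<in>K. \<Sum>y\<in>K. cnj (a x) * b y * (cnj (X x \<omega>) * X y \<omega>)) + cnj u * v +
      cnj u * (\<Sum>y\<in>K. b y * X y \<omega>) + v * (\<Sum>x\<in>K. cnj (a x) * cnj (X x \<omega>)))
    ((\<Sum>x\<in>K. \<Sum>y\<in>K. cnj (a x) * b y * (if x = y then 1 else 0)) + cnj u * v +
      cnj u * (\<Sum>y\<in>K. b y * 0) + v * (\<Sum>x\<in>K. cnj (a x) * cnj 0))"
    by (intro has_bochner_integral_add has_bochner_integral_sum has_bochner_integral_mult_right
        has_bochner_integral_cnj mean cov)
       (auto simp: has_bochner_integral_iff prob_space)
  moreover have "cnj (u + (\<Sum>x\<in>K. z x * a x)) * (v + (\<Sum>x\<in>K. z x * b x)) =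
      (\<Sum>x\<in>K. \<Sum>y\<in>K. cnj (a x) * b y * (cnj (z x) * z y)) + cnj u * v +
      cnj u * (\<Sum>y\<in>K. b y * z y) + v * (\<Sum>x\<in>K. cnj (a x) * cnj (z x))" for z
  proof -
    have "(\<Sum>x\<in>K. \<Sum>y\<in>K. cnj (a x) * b y * (cnj (z x) * z y)) =
        (\<Sum>x\<in>K. cnj (a x) * cnj (z x)) * (\<Sum>y\<in>K. b y * z y)"
      unfolding sum_product by (simp add: mult_ac)
    then show ?thesis
      by (simp add: algebra_simps)
  qed
  ultimately show ?thesis
    using fin by (simp add: if_distrib cong: if_cong)
qed

lemma indep_vars_affine_rows:
  fixes X :: "'r \<times> 'x \<Rightarrow> 'a \<Rightarrow> complex"
  assumes "indep_vars (\<lambda>_. borel) X (R \<times> K)"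
  shows "indep_vars (\<lambda>_. PiM C (\<lambda>_. borel))
    (\<lambda>r \<omega>. \<lambda>j\<in>C. m r j + (\<Sum>x\<in>K. X (r, x) \<omega> * b x j)) R"
proof -
  let ?row = "\<lambda>r v. \<lambda>j\<in>C. m r j + (\<Sum>x\<in>K. v (r, x) * b x j)"
  have "indep_vars (\<lambda>r. PiM ({r} \<times> K) (\<lambda>_. borel)) (\<lambda>r \<omega>. restrict (\<lambda>z. X z \<omega>) ({r} \<times> K)) R"
    by (rule indep_vars_restrict[OF assms]) (auto simp: disjoint_family_on_def)
  then have "indep_vars (\<lambda>_. PiM C (\<lambda>_. borel)) (\<lambda>r \<omega>. ?row r (restrict (\<lambda>z. X z \<omega>) ({r} \<times> K))) R"
  proof (rule indep_vars_compose2)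
    show "?row r \<in> PiM ({r} \<times> K) (\<lambda>_. borel) \<rightarrow>\<^sub>M PiM C (\<lambda>_. borel)" for r
      by (intro measurable_restrict borel_measurable_add borel_measurable_sum borel_measurable_times
          measurable_const measurable_component_singleton) auto
  qed
  then show ?thesis
    by simp
qed

end

locale independent_rows = prob_space M for M :: "'a measure" +
  fixes A :: "'a \<Rightarrow> complex mat" and B \<Psi> :: "complex mat" and n k :: nat
  assumes A_carrier: "A \<omega> \<in> carrier_mat n k" and B_carrier: "B \<in> carrier_mat n k"
    and k_le_n: "k \<le> n"
    and indep_rows:
      "indep_vars (\<lambda>_. PiM {..<k} (\<lambda>_. borel)) (\<lambda>r \<omega>. \<lambda>j\<in>{..<k}. A \<omega> $$ (r, j)) {..<n}"
    and second_moment: "r < n \<Longrightarrow> i < k \<Longrightarrow> j < k \<Longrightarrow>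
      has_bochner_integral M (\<lambda>\<omega>. cnj (A \<omega> $$ (r, i)) * A \<omega> $$ (r, j))
        (\<Psi> $$ (i, j) + cnj (B $$ (r, i)) * B $$ (r, j))"
    and nonsingular: "Q \<subseteq> {..<k} \<Longrightarrow> det (principal_submat \<Psi> Q) \<noteq> 0"
begin

lemma has_bochner_integral_gram_minor:
  assumes Q: "Q \<subseteq> {..<k}"
  shows "has_bochner_integral M (\<lambda>\<omega>. det_on Q (\<lambda>i j. \<Sum>r<n. cnj (A \<omega> $$ (r, i)) * A \<omega> $$ (r, j)))
    (expected_gram_minor n \<Psi> (ctrans B * B) Q)"
proof -
  let ?\<psi> = "\<lambda>i j. \<Psi> $$ (i, j)" and ?\<sigma> = "\<lambda>i j. (ctrans B * B) $$ (i, j)"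
    and ?gram = "\<lambda>i j. \<Sum>r<n. cnj (B $$ (r, i)) * B $$ (r, j)"
  let ?c = "\<lambda>r i j. ?\<psi> i j + cnj (B $$ (r, i)) * B $$ (r, j)"
  have fin: "finite Q" and card: "card Q \<le> n"
    using Q k_le_n card_mono[of "{..<k}" Q] finite_subset by auto
  have gram: "det_on Q (override_on ?\<psi> ?gram U) = det_on Q (override_on ?\<psi> ?\<sigma> U)" for U
    by (rule det_on_cong)
       (simp add: override_on_def index_ctrans_mult[OF B_carrier] subsetD[OF Q, simplified]
         del: index_mult_mat(1))
  have "fact (n - card Q) * (\<Sum>f\<in>inj_PiE Q {..<n}. det_on Q (\<lambda>i j. ?c (f i) i j)) =
      (\<Sum>U\<in>Pow Q. fact (n - card U) * det_on Q (override_on ?\<psi> ?\<sigma> U))"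
    using sum_det_on_shifted_gram[of Q "{..<n}" ?\<psi> "\<lambda>r i. cnj (B $$ (r, i))" "\<lambda>r j. B $$ (r, j)"]
      fin card by (simp add: gram)
  also have "\<dots> = fact (n - card Q) * expected_gram_minor n \<Psi> (ctrans B * B) Q"
    by (rule sum_det_on_eq_expected_gram_minor[OF fin card nonsingular[OF Q]])
  finally have "expected_gram_minor n \<Psi> (ctrans B * B) Q =
      (\<Sum>f\<in>inj_PiE Q {..<n}. det_on Q (\<lambda>i j. ?c (f i) i j))"
    by simp
  then show ?thesis
    using has_bochner_integral_det_on_gram[OF fin finite_lessThan Q indep_rows, of ?c] Q
    by (auto intro: second_moment)
qed

lemma has_bochner_integral_det_one_plus_gram:
  "has_bochner_integral M (\<lambda>\<omega>. det (1\<^sub>m n + c \<cdot>\<^sub>m (A \<omega> * ctrans (A \<omega>))))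
    (\<Sum>t\<le>k. c ^ t * (\<Sum>Q\<in>{Q. Q \<subseteq> {..<k} \<and> card Q = t}. expected_gram_minor n \<Psi> (ctrans B * B) Q))"
proof -
  let ?E = "expected_gram_minor n \<Psi> (ctrans B * B)"
  have "has_bochner_integral M (\<lambda>\<omega>. det (1\<^sub>m n + c \<cdot>\<^sub>m (A \<omega> * ctrans (A \<omega>))))
      (\<Sum>Q\<in>Pow {..<k}. c ^ card Q * ?E Q)"
    unfolding det_one_plus_gram_eq_sum_minors[OF A_carrier]
    by (intro has_bochner_integral_sum has_bochner_integral_mult_right
        has_bochner_integral_gram_minor) auto
  also have "(\<Sum>Q\<in>Pow {..<k}. c ^ card Q * ?E Q) =
      (\<Sum>t\<le>k. \<Sum>Q\<in>{Q \<in> Pow {..<k}. card Q = t}. c ^ card Q * ?E Q)"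
    by (rule sum.group[symmetric]) (use card_mono[of "{..<k}"] in auto)
  also have "\<dots> = (\<Sum>t\<le>k. c ^ t * (\<Sum>Q\<in>{Q. Q \<subseteq> {..<k} \<and> card Q = t}. ?E Q))"
    unfolding sum_distrib_left by (intro sum.cong) auto
  finally show ?thesis .
qed

theorem nn_integral_log_det_one_plus_gram_le:
  assumes "0 \<le> c" "1 < b"
  shows "(\<integral>\<^sup>+ \<omega>. ennreal (log b (Re (det (1\<^sub>m n + complex_of_real c \<cdot>\<^sub>m (A \<omega> * ctrans (A \<omega>)))))) \<partial>M)
    \<le> ennreal (log b (Re (\<Sum>t\<le>k. complex_of_real (c ^ t) *
        (\<Sum>Q\<in>{Q. Q \<subseteq> {..<k} \<and> card Q = t}. expected_gram_minor n \<Psi> (ctrans B * B) Q))))"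
  unfolding of_real_power
proof (rule nn_integral_log_le_log_mean)
  show "1 \<le> Re (det (1\<^sub>m n + complex_of_real c \<cdot>\<^sub>m (A \<omega> * ctrans (A \<omega>))))" for \<omega>
    by (rule Re_det_one_plus_gram_ge_1[OF A_carrier assms(1)])
  show "has_bochner_integral M (\<lambda>\<omega>. Re (det (1\<^sub>m n + complex_of_real c \<cdot>\<^sub>m (A \<omega> * ctrans (A \<omega>)))))
      (Re (\<Sum>t\<le>k. complex_of_real c ^ t *
        (\<Sum>Q\<in>{Q. Q \<subseteq> {..<k} \<and> card Q = t}. expected_gram_minor n \<Psi> (ctrans B * B) Q)))"
    using has_bochner_integral_det_one_plus_gram[of "complex_of_real c"]
    by (simp only: has_bochner_integral_iff integrable_Re integral_Re)
qed fact

end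

section \<open>Complex Gaussian matrices\<close>

lemma borel_measurable_Complex [measurable]:
  "(\<lambda>(x, y). Complex x y) \<in> borel_measurable (borel \<Otimes>\<^sub>M borel)"
  unfolding Complex_eq case_prod_beta by measurable

lemma lborel_complex_eq_distr:
  "(lborel :: complex measure) = distr (lborel \<Otimes>\<^sub>M lborel) borel (\<lambda>(x, y). Complex x y)"
proof (rule lborel_eqI)
  let ?D = "distr (lborel \<Otimes>\<^sub>M lborel) borel (\<lambda>(x, y). Complex x y)"
  fix l u :: complex
  assume lu: "\<And>b. b \<in> Basis \<Longrightarrow> l \<bullet> b \<le> u \<bullet> b"
  have le: "Re l \<le> Re u" "Im l \<le> Im u"
    using lu[of 1] lu[of \<i>] by (auto simp: Basis_complex_def inner_complex_def)
  have "(\<lambda>(x, y). Complex x y) -` box l u \<inter> space (lborel \<Otimes>\<^sub>M lborel) =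
      {Re l<..<Re u} \<times> {Im l<..<Im u}"
    by (auto simp: in_box_complex_iff space_pair_measure)
  then have "emeasure ?D (box l u) = emeasure (lborel \<Otimes>\<^sub>M lborel) ({Re l<..<Re u} \<times> {Im l<..<Im u})"
    by (simp add: emeasure_distr)
  also have "\<dots> = ennreal ((Re u - Re l) * (Im u - Im l))"
    using le by (simp add: lborel.emeasure_pair_measure_Times ennreal_mult)
  finally show "emeasure ?D (box l u) = ennreal (\<Prod>b\<in>Basis. (u - l) \<bullet> b)"
    by (simp add: Basis_complex_def inner_complex_def)
qed simp

abbreviation normal_half :: "real measure" where
  "normal_half \<equiv> density lborel (normal_density 0 (1 / sqrt 2))"

interpretation normal_half: prob_space normal_half
  by (rule prob_space_normal_density) simp

interpretation normal_half_pair: pair_prob_space normal_half normal_half ..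

lemma cgauss_eq_distr:
  "cgauss = distr (normal_half \<Otimes>\<^sub>M normal_half) borel (\<lambda>(x, y). Complex x y)"
proof -
  have "cgauss = distr (density (lborel \<Otimes>\<^sub>M lborel)
      (\<lambda>w. ennreal (exp (- (cmod (case w of (x, y) \<Rightarrow> Complex x y))\<^sup>2) / pi)))
      borel (\<lambda>(x, y). Complex x y)"
    unfolding cgauss_def lborel_complex_eq_distr by (subst density_distr) measurable
  also have "(\<lambda>w. ennreal (exp (- (cmod (case w of (x, y) \<Rightarrow> Complex x y))\<^sup>2) / pi)) =
      (\<lambda>(x, y). ennreal (normal_density 0 (1 / sqrt 2) x) *
        ennreal (normal_density 0 (1 / sqrt 2) y))"
    by (auto simp: fun_eq_iff normal_density_def cmod_def ennreal_mult[symmetric] power_divide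
        exp_add[symmetric] field_simps simp flip: exp_minus)
  also have "density (lborel \<Otimes>\<^sub>M lborel) \<dots> = normal_half \<Otimes>\<^sub>M normal_half"
    by (rule pair_measure_density[symmetric])
       (auto intro: normal_half.sigma_finite_measure_axioms lborel.sigma_finite_measure_axioms)
  finally show ?thesis .
qed

lemma sets_cgauss [measurable_cong, simp]: "sets cgauss = sets borel"
  by (simp add: cgauss_def)

interpretation cgauss: prob_space cgauss
  unfolding cgauss_eq_distr by (rule normal_half_pair.P.prob_space_distr) measurable

lemma normal_half_mean: "has_bochner_integral normal_half (\<lambda>x. x) 0"
  and normal_half_variance: "has_bochner_integral normal_half (\<lambda>x. x\<^sup>2) (1 / 2)"
  using normal_moment_nz_1[of "1 / sqrt 2" 0] normal_moment_even[of "1 / sqrt 2" 0 1]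
  by (auto intro!: has_bochner_integral_density simp: power_divide)

lemma cgauss_mean: "has_bochner_integral cgauss (\<lambda>z. z) 0"
proof -
  have "has_bochner_integral (normal_half \<Otimes>\<^sub>M normal_half)
      (\<lambda>w. complex_of_real (fst w) + \<i> * complex_of_real (snd w))
      (complex_of_real 0 + \<i> * complex_of_real 0)"
    by (intro has_bochner_integral_add has_bochner_integral_mult_right has_bochner_integral_of_real
        normal_half_pair.has_bochner_integral_fst normal_half_pair.has_bochner_integral_snd
        normal_half_mean)
  then show ?thesis
    unfolding cgauss_eq_distr
    by (intro has_bochner_integral_distr) (simp_all add: case_prod_beta Complex_eq)
qed

lemma cgauss_variance: "has_bochner_integral cgauss (\<lambda>z. cnj z * z) 1"
proof -
  have "has_bochner_integral (normal_half \<Otimes>\<^sub>M normal_half)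
      (\<lambda>w. complex_of_real ((fst w)\<^sup>2 + (snd w)\<^sup>2)) (complex_of_real (1 / 2 + 1 / 2))"
    by (intro has_bochner_integral_of_real has_bochner_integral_add normal_half_variance
        normal_half_pair.has_bochner_integral_fst[where f = "\<lambda>x. x\<^sup>2"]
        normal_half_pair.has_bochner_integral_snd[where f = "\<lambda>x. x\<^sup>2"])
  also have "(\<lambda>w. complex_of_real ((fst w)\<^sup>2 + (snd w)\<^sup>2)) =
      (\<lambda>w. cnj (Complex (fst w) (snd w)) * Complex (fst w) (snd w))"
    by (simp add: fun_eq_iff complex_eq_iff power2_eq_square)
  finally show ?thesis
    unfolding cgauss_eq_distr
    by (intro has_bochner_integral_distr) (simp_all add: case_prod_beta)
qed

lemma prob_space_cgauss_mat_measure: "prob_space (cgauss_mat_measure n k)"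
  unfolding cgauss_mat_measure_def by (rule prob_space_PiM) (rule cgauss.prob_space_axioms)

abbreviation cgauss_mat_pair ::
  "nat \<Rightarrow> nat \<Rightarrow> nat \<Rightarrow> ((nat \<times> nat \<Rightarrow> complex) \<times> (nat \<times> nat \<Rightarrow> complex)) measure" where
  "cgauss_mat_pair n m k \<equiv> cgauss_mat_measure n m \<Otimes>\<^sub>M cgauss_mat_measure n k"

lemma pair_prob_space_cgauss_mat:
  "pair_prob_space (cgauss_mat_measure n m) (cgauss_mat_measure n k)"
proof -
  interpret M1: prob_space "cgauss_mat_measure n m"
    by (rule prob_space_cgauss_mat_measure)
  interpret M2: prob_space "cgauss_mat_measure n k"
    by (rule prob_space_cgauss_mat_measure)
  show ?thesis ..
qed

fun cgauss_entry ::
  "nat \<times> (nat + nat) \<Rightarrow> (nat \<times> nat \<Rightarrow> complex) \<times> (nat \<times> nat \<Rightarrow> complex) \<Rightarrow> complex" where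
  "cgauss_entry (r, Inl a) w = fst w (r, a)"
| "cgauss_entry (r, Inr l) w = snd w (r, l)"

lemma indep_vars_cgauss_entry:
  "prob_space.indep_vars (cgauss_mat_pair n m k) (\<lambda>_. borel) cgauss_entry
    ({..<n} \<times> ({..<m} <+> {..<k}))"
proof -
  interpret pair_prob_space "cgauss_mat_measure n m" "cgauss_mat_measure n k"
    by (rule pair_prob_space_cgauss_mat)
  let ?Z = "case_sum (\<lambda>i w. fst w i) (\<lambda>i w. snd w i) ::
    _ \<Rightarrow> (nat \<times> nat \<Rightarrow> complex) \<times> (nat \<times> nat \<Rightarrow> complex) \<Rightarrow> complex"
  let ?f = "\<lambda>(r, x). case x of Inl a \<Rightarrow> Inl (r, a) | Inr l \<Rightarrow> Inr (r, l)"
  have "P.indep_vars (case_sum (\<lambda>_. cgauss) (\<lambda>_. cgauss)) ?Z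
      (({..<n} \<times> {..<m}) <+> ({..<n} \<times> {..<k}))"
    by (rule indep_vars_Plus; unfold cgauss_mat_measure_def; rule indep_vars_PiM_component;
        unfold_locales)
  then have "P.indep_vars (\<lambda>z. case_sum (\<lambda>_. cgauss) (\<lambda>_. cgauss) (?f z)) (\<lambda>z. ?Z (?f z))
      ({..<n} \<times> ({..<m} <+> {..<k}))"
    by (rule P.indep_vars_reindex) (auto simp: inj_on_def split: sum.splits)
  then have "P.indep_vars (\<lambda>_. borel) (\<lambda>z w. (\<lambda>v. v) (?Z (?f z) w)) ({..<n} \<times> ({..<m} <+> {..<k}))"
    by (rule P.indep_vars_compose2) (auto intro: measurable_ident_sets split: sum.splits)
  also have "(\<lambda>z w. (\<lambda>v. v) (?Z (?f z) w)) = cgauss_entry"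
    by (auto simp: fun_eq_iff split: sum.splits)
  finally show ?thesis .
qed

lemma has_bochner_integral_cgauss_entry:
  fixes f :: "complex \<Rightarrow> complex"
  assumes z: "z \<in> {..<n} \<times> ({..<m} <+> {..<k})" and f: "has_bochner_integral cgauss f c"
  shows "has_bochner_integral (cgauss_mat_pair n m k) (\<lambda>w. f (cgauss_entry z w)) c"
proof -
  interpret pair_prob_space "cgauss_mat_measure n m" "cgauss_mat_measure n k"
    by (rule pair_prob_space_cgauss_mat)
  have entry: "has_bochner_integral (cgauss_mat_measure n k) (\<lambda>w. f (w (r, j))) c"
    if "r < n" "j < k" for r j k
    unfolding cgauss_mat_measure_def
    by (rule has_bochner_integral_PiM_component) (use that f cgauss.prob_space_axioms in auto)
  from z show ?thesis
    using has_bochner_integral_fst[OF entry] has_bochner_integral_snd[OF entry] by auto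
qed

text \<open>The rows of \<open>W F + s V\<close>, for independent noise matrices \<open>W\<close> and \<open>V\<close>, are images of the rows of
  the block matrix \<open>(W V)\<close> under one linear map, whose coefficients these are.\<close>

fun noise_coeff :: "complex mat \<Rightarrow> complex \<Rightarrow> nat + nat \<Rightarrow> nat \<Rightarrow> complex" where
  "noise_coeff F s (Inl a) j = F $$ (a, j)"
| "noise_coeff F s (Inr l) j = (if l = j then s else 0)"

lemma index_affine_cgauss_mat:
  assumes B: "B \<in> carrier_mat n k" and F: "F \<in> carrier_mat m k" and "r < n" "j < k"
  shows "(B + to_mat n m (fst w) * F + s \<cdot>\<^sub>m to_mat n k (snd w)) $$ (r, j) =
    B $$ (r, j) + (\<Sum>x\<in>{..<m} <+> {..<k}. cgauss_entry (r, x) w * noise_coeff F s x j)"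
proof -
  have "(to_mat n m (fst w) * F) $$ (r, j) = (\<Sum>a<m. fst w (r, a) * F $$ (a, j))"
    using assms by (simp add: to_mat_def scalar_prod_def lessThan_atLeast0)
  moreover have "(\<Sum>l<k. snd w (r, l) * (if l = j then s else 0)) = s * snd w (r, j)"
    using assms by (simp add: if_distrib[of "(*) _"] mult.commute cong: if_cong)
  ultimately show ?thesis
    using assms by (simp add: sum.Plus to_mat_def del: index_mult_mat(1))
qed

lemma gram_noise_coeff:
  assumes F: "F \<in> carrier_mat m k" and ij: "i < k" "j < k"
  shows "(\<Sum>x\<in>{..<m} <+> {..<k}. cnj (noise_coeff F s x i) * noise_coeff F s x j) =
    (ctrans F * F + (cnj s * s) \<cdot>\<^sub>m 1\<^sub>m k) $$ (i, j)"
proof -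
  have "cnj (noise_coeff F s (Inr l) i) * noise_coeff F s (Inr l) j =
      (if l = i then if i = j then cnj s * s else 0 else 0)" for l
    by simp
  then show ?thesis
    using assms ctrans_carrier[OF F] index_ctrans_mult[OF F ij]
    by (simp add: sum.Plus del: index_mult_mat(1) noise_coeff.simps(2))
qed

lemma indep_vars_affine_cgauss_mat_rows:
  assumes B: "B \<in> carrier_mat n k" and F: "F \<in> carrier_mat m k"
  shows "prob_space.indep_vars (cgauss_mat_pair n m k) (\<lambda>_. PiM {..<k} (\<lambda>_. borel))
    (\<lambda>r w. \<lambda>j\<in>{..<k}. (B + to_mat n m (fst w) * F + s \<cdot>\<^sub>m to_mat n k (snd w)) $$ (r, j)) {..<n}"
proof -
  interpret pair_prob_space "cgauss_mat_measure n m" "cgauss_mat_measure n k"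
    by (rule pair_prob_space_cgauss_mat)
  let ?row = "\<lambda>r w. \<lambda>j\<in>{..<k}.
    B $$ (r, j) + (\<Sum>x\<in>{..<m} <+> {..<k}. cgauss_entry (r, x) w * noise_coeff F s x j)"
  have "P.indep_vars (\<lambda>_. PiM {..<k} (\<lambda>_. borel)) ?row {..<n}"
    by (rule P.indep_vars_affine_rows[OF indep_vars_cgauss_entry])
  moreover have "(\<lambda>w. \<lambda>j\<in>{..<k}.
      (B + to_mat n m (fst w) * F + s \<cdot>\<^sub>m to_mat n k (snd w)) $$ (r, j)) = ?row r" if "r \<in> {..<n}" for r
    using that by (intro ext restrict_ext) (simp only: index_affine_cgauss_mat[OF B F] lessThan_iff)
  ultimately show ?thesis
    by (simp only: cong: P.indep_vars_cong)
qed

lemma affine_cgauss_mat_second_moment: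
  fixes s :: complex
  assumes B: "B \<in> carrier_mat n k" and F: "F \<in> carrier_mat m k"
    and r: "r < n" and ij: "i < k" "j < k"
  defines "A \<equiv> \<lambda>w. B + to_mat n m (fst w) * F + s \<cdot>\<^sub>m to_mat n k (snd w)"
  shows "has_bochner_integral (cgauss_mat_pair n m k) (\<lambda>w. cnj (A w $$ (r, i)) * A w $$ (r, j))
    ((ctrans F * F + (cnj s * s) \<cdot>\<^sub>m 1\<^sub>m k) $$ (i, j) + cnj (B $$ (r, i)) * B $$ (r, j))"
proof -
  interpret pair_prob_space "cgauss_mat_measure n m" "cgauss_mat_measure n k"
    by (rule pair_prob_space_cgauss_mat)
  let ?K = "{..<m} <+> {..<k}"
  have mean: "has_bochner_integral (cgauss_mat_pair n m k) (cgauss_entry (r, x)) 0"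
    and var: "has_bochner_integral (cgauss_mat_pair n m k)
      (\<lambda>w. cnj (cgauss_entry (r, x) w) * cgauss_entry (r, x) w) 1" if "x \<in> ?K" for x
    using r that has_bochner_integral_cgauss_entry[OF _ cgauss_mean, of "(r, x)" n m k]
      has_bochner_integral_cgauss_entry[OF _ cgauss_variance, of "(r, x)" n m k] by auto
  have "P.indep_vars (\<lambda>_. borel) (\<lambda>x. cgauss_entry (r, x)) ?K"
    by (rule P.indep_vars_reindex[OF indep_vars_cgauss_entry]) (use r in \<open>auto simp: inj_on_def\<close>)
  then show ?thesis
    unfolding A_def index_affine_cgauss_mat[OF B F r ij(1)] index_affine_cgauss_mat[OF B F r ij(2)]
      gram_noise_coeff[OF F ij, symmetric]
    by (intro P.has_bochner_integral_affine_covariance P.has_bochner_integral_cnj_mult_indep mean var)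
       auto
qed

lemma independent_rows_cgauss_mat:
  assumes B: "B \<in> carrier_mat n k" and F: "F \<in> carrier_mat m k" and "k \<le> n" and s: "0 < s"
  shows "independent_rows (cgauss_mat_pair n m k)
    (\<lambda>w. B + to_mat n m (fst w) * F + complex_of_real s \<cdot>\<^sub>m to_mat n k (snd w)) B
    (ctrans F * F + complex_of_real (s\<^sup>2) \<cdot>\<^sub>m 1\<^sub>m k) n k"
proof -
  interpret pair_prob_space "cgauss_mat_measure n m" "cgauss_mat_measure n k"
    by (rule pair_prob_space_cgauss_mat)
  have cnj_s: "cnj (complex_of_real s) * complex_of_real s = complex_of_real (s\<^sup>2)"
    by (simp add: power2_eq_square)
  show ?thesis
  proof
    show "B + to_mat n m (fst w) * F + complex_of_real s \<cdot>\<^sub>m to_mat n k (snd w) \<in> carrier_mat n k"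
      for w
      by (simp add: to_mat_def)
  qed (use B \<open>k \<le> n\<close> s indep_vars_affine_cgauss_mat_rows[OF B F]
      affine_cgauss_mat_second_moment[OF B F, where s = "complex_of_real s", unfolded cnj_s]
      det_principal_submat_gram_plus_scalar_nonzero[OF F] in \<open>simp_all del: of_real_power\<close>)
qed

section \<open>The RIS-aided channel\<close>

lemma ris_phase_carrier: "ris_phase M ph \<in> carrier_mat M M"
  by (simp add: ris_phase_def)

lemma index_ris_phase_mult:
  assumes "T \<in> carrier_mat M k" "a < M" "j < k"
  shows "(ris_phase M ph * T) $$ (a, j) = cis (ph a) * T $$ (a, j)"
proof -
  have "(ris_phase M ph * T) $$ (a, j) = (\<Sum>i<M. (if a = i then cis (ph a) else 0) * T $$ (i, j))"
    using assms by (simp add: ris_phase_def scalar_prod_def lessThan_atLeast0)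
  also have "\<dots> = (\<Sum>i<M. if a = i then cis (ph a) * T $$ (i, j) else 0)"
    by (rule sum.cong) auto
  finally show ?thesis
    using assms(2) by simp
qed

lemma gram_ris_phase_mult:
  assumes T: "T \<in> carrier_mat M k"
  shows "ctrans (ris_phase M ph * T) * (ris_phase M ph * T) = ctrans T * T"
proof (rule eq_matI)
  let ?F = "ris_phase M ph * T"
  have F: "?F \<in> carrier_mat M k"
    using T ris_phase_carrier by (rule mult_carrier_mat[rotated])
  show "dim_row (ctrans ?F * ?F) = dim_row (ctrans T * T)"
    and "dim_col (ctrans ?F * ?F) = dim_col (ctrans T * T)"
    using F T by (simp_all add: ctrans_def)
  fix i j assume "i < dim_row (ctrans T * T)" "j < dim_col (ctrans T * T)"
  then have ij: "i < k" "j < k"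
    using T by (simp_all add: ctrans_def)
  show "(ctrans ?F * ?F) $$ (i, j) = (ctrans T * T) $$ (i, j)"
    unfolding index_ctrans_mult[OF F ij] index_ctrans_mult[OF T ij]
  proof (rule sum.cong)
    fix r assume "r \<in> {..<M}"
    then have r: "r < M"
      by simp
    have "cnj (?F $$ (r, i)) * ?F $$ (r, j) =
        (cnj (cis (ph r)) * cis (ph r)) * (cnj (T $$ (r, i)) * T $$ (r, j))"
      unfolding index_ris_phase_mult[OF T r ij(1)] index_ris_phase_mult[OF T r ij(2)]
      by (simp only: complex_cnj_mult mult_ac)
    also have "cnj (cis (ph r)) * cis (ph r) = 1"
      by (simp add: cis_cnj cis_mult)
    finally show "cnj (?F $$ (r, i)) * ?F $$ (r, j) = cnj (T $$ (r, i)) * T $$ (r, j)"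
      by simp
  qed simp
qed

lemma ris_channel_eq_mean_plus_noise:
  fixes Rb W \<Phi> T Hb V :: "complex mat"
  assumes carr: "Rb \<in> carrier_mat n M" "W \<in> carrier_mat n M" "\<Phi> \<in> carrier_mat M M"
    "T \<in> carrier_mat M k" "Hb \<in> carrier_mat n k" "V \<in> carrier_mat n k"
  shows "complex_of_real (sqrt p) \<cdot>\<^sub>m
      ((complex_of_real (sqrt LR) \<cdot>\<^sub>m Rb + complex_of_real (sqrt NR) \<cdot>\<^sub>m W) * \<Phi> * T) +
      complex_of_real (sqrt q) \<cdot>\<^sub>m
        (complex_of_real (sqrt LH) \<cdot>\<^sub>m Hb + complex_of_real (sqrt NH) \<cdot>\<^sub>m V) =
    complex_of_real (sqrt (p * LR)) \<cdot>\<^sub>m (Rb * \<Phi> * T) + complex_of_real (sqrt (q * LH)) \<cdot>\<^sub>m Hb +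
      W * (complex_of_real (sqrt (p * NR)) \<cdot>\<^sub>m (\<Phi> * T)) + complex_of_real (sqrt (q * NH)) \<cdot>\<^sub>m V"
proof -
  have \<Phi>T: "\<Phi> * T \<in> carrier_mat M k"
    using carr by simp
  have assoc: "X * \<Phi> * T = X * (\<Phi> * T)" if "X \<in> carrier_mat n M" for X
    by (rule assoc_mult_mat) (use carr that in auto)
  define Z Y where "Z = Rb * (\<Phi> * T)" and "Y = W * (\<Phi> * T)"
  have ZY: "Z \<in> carrier_mat n k" "Y \<in> carrier_mat n k"
    using carr \<Phi>T by (auto simp: Z_def Y_def)
  have "(a \<cdot>\<^sub>m Rb + b \<cdot>\<^sub>m W) * \<Phi> * T = a \<cdot>\<^sub>m Z + b \<cdot>\<^sub>m Y" for a b
    using carr(1,2) \<Phi>T unfolding Z_def Y_def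
    by (simp add: assoc add_mult_distrib_mat[of _ n M _ _ k] mult_smult_assoc_mat[of _ n M _ k])
  moreover have "Rb * \<Phi> * T = Z" "W * (c \<cdot>\<^sub>m (\<Phi> * T)) = c \<cdot>\<^sub>m Y" for c
    using carr(1,2) \<Phi>T unfolding Z_def Y_def
    by (simp_all add: assoc mult_smult_distrib[of _ n M _ k])
  ultimately show ?thesis
    using carr(5,6) ZY by (simp only:) (intro eq_matI; simp add: real_sqrt_mult algebra_simps)
qed

lemma independent_rows_ris_channel:
  fixes ph :: "nat \<Rightarrow> real"
  assumes carr: "T \<in> carrier_mat M k" "Rb \<in> carrier_mat n M" "Hb \<in> carrier_mat n k"
    and "k \<le> n" "0 \<le> p" "0 \<le> NR" "0 < q" "0 < NH"
  defines "\<Phi> \<equiv> ris_phase M ph"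
  shows "independent_rows (cgauss_mat_pair n M k)
    (\<lambda>w. complex_of_real (sqrt p) \<cdot>\<^sub>m
        ((complex_of_real (sqrt LR) \<cdot>\<^sub>m Rb + complex_of_real (sqrt NR) \<cdot>\<^sub>m to_mat n M (fst w)) *
          \<Phi> * T) +
      complex_of_real (sqrt q) \<cdot>\<^sub>m
        (complex_of_real (sqrt LH) \<cdot>\<^sub>m Hb + complex_of_real (sqrt NH) \<cdot>\<^sub>m to_mat n k (snd w)))
    (complex_of_real (sqrt (p * LR)) \<cdot>\<^sub>m (Rb * \<Phi> * T) + complex_of_real (sqrt (q * LH)) \<cdot>\<^sub>m Hb)
    (complex_of_real (p * NR) \<cdot>\<^sub>m (ctrans T * T) + complex_of_real (q * NH) \<cdot>\<^sub>m 1\<^sub>m k) n k"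
proof -
  define F where "F = complex_of_real (sqrt (p * NR)) \<cdot>\<^sub>m (\<Phi> * T)"
  define B where "B = complex_of_real (sqrt (p * LR)) \<cdot>\<^sub>m (Rb * \<Phi> * T) +
    complex_of_real (sqrt (q * LH)) \<cdot>\<^sub>m Hb"
  have \<Phi>: "\<Phi> \<in> carrier_mat M M" "\<Phi> * T \<in> carrier_mat M k"
    using carr ris_phase_carrier[of M ph] by (auto simp: \<Phi>_def)
  have "ctrans F * F = complex_of_real (p * NR) \<cdot>\<^sub>m (ctrans T * T)"
    unfolding F_def gram_smult[OF \<Phi>(2)] unfolding \<Phi>_def gram_ris_phase_mult[OF carr(1)]
    using assms(5,6) by (simp flip: of_real_mult)
  moreover have "(sqrt (q * NH))\<^sup>2 = q * NH"
    using assms(7,8) by simp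
  moreover have "independent_rows (cgauss_mat_pair n M k)
      (\<lambda>w. B + to_mat n M (fst w) * F + complex_of_real (sqrt (q * NH)) \<cdot>\<^sub>m to_mat n k (snd w)) B
      (ctrans F * F + complex_of_real ((sqrt (q * NH))\<^sup>2) \<cdot>\<^sub>m 1\<^sub>m k) n k"
    by (rule independent_rows_cgauss_mat) (use assms carr \<Phi> in \<open>simp_all add: B_def F_def\<close>)
  ultimately show ?thesis
    unfolding B_def F_def
    by (subst ris_channel_eq_mean_plus_noise[of _ n M _ _ _ k])
       (use carr \<Phi> in \<open>simp_all add: to_mat_def\<close>)
qed

theorem theorem1:
  fixes Nt Nr Mh Mv PT PR PH :: nat
    and dtl drl dhl dvl :: real
    and tg rg hg :: "nat \<Rightarrow> complex"
    and phA1 thA1 thD1 thA2 phD2 thD2 thA3 thD3 :: "nat \<Rightarrow> real"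
    and phase :: "nat \<Rightarrow> real"
    and bt br bd LR NR LH NH \<rho> :: real
  assumes "Nt > 0" "Nr \<ge> Nt" "Mh > 0" "Mv > 0"
    and "PT > 0" "PR > 0" "PH > 0"
    and "dtl > 0" "drl > 0" "dhl > 0" "dvl > 0"
    and "bt > 0" "br > 0" "bd > 0"
    and "LR \<ge> 0" "NR \<ge> 0" "LR + NR = 1"
    and "LH \<ge> 0" "NH > 0" "LH + NH = 1"
    and "\<rho> > 0"
  shows
   "(let M = Mh * Mv;
         T = LoS_T Mh Mv Nt dhl dvl dtl PT tg phA1 thA1 thD1;
         Rb = LoS_R Mh Mv Nr dhl dvl drl PR rg thA2 phD2 thD2;
         Hb = LoS_H Nr Nt drl dtl PH hg thA3 thD3;
         \<Phi> = ris_phase M phase;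
         \<rho>b = \<rho> / real Nt;
         Gb = complex_of_real (sqrt (bt * br * LR)) \<cdot>\<^sub>m (Rb * \<Phi> * T)
              + complex_of_real (sqrt (bd * LH)) \<cdot>\<^sub>m Hb;
         \<Psi> = complex_of_real (bt * br * NR) \<cdot>\<^sub>m (ctrans T * T)
              + complex_of_real (bd * NH) \<cdot>\<^sub>m (1\<^sub>m Nt);
         \<Sigma> = ctrans Gb * Gb;
         G = (\<lambda>wR wH.
               let R = complex_of_real (sqrt LR) \<cdot>\<^sub>m Rb + complex_of_real (sqrt NR) \<cdot>\<^sub>m to_mat Nr M wR;
                   H = complex_of_real (sqrt LH) \<cdot>\<^sub>m Hb + complex_of_real (sqrt NH) \<cdot>\<^sub>m to_mat Nr Nt wH
               in complex_of_real (sqrt (bt * br)) \<cdot>\<^sub>m (R * \<Phi> * T) + complex_of_real (sqrt bd) \<cdot>\<^sub>m H);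
         C = (\<integral>\<^sup>+ w. ennreal (log 2 (Re (det (1\<^sub>m Nr + complex_of_real \<rho>b \<cdot>\<^sub>m
                      (G (fst w) (snd w) * ctrans (G (fst w) (snd w)))))))
                \<partial>(cgauss_mat_measure Nr M \<Otimes>\<^sub>M cgauss_mat_measure Nr Nt));
         bound = (\<Sum>t\<le>Nt. complex_of_real (\<rho>b ^ t) *
                   (\<Sum>Q\<in>{Q. Q \<subseteq> {..<Nt} \<and> card Q = t}.
                      let \<theta>s = nonzero_eigvals (minv (principal_submat \<Psi> Q) * principal_submat \<Sigma> Q);
                          L = length \<theta>s
                      in det (principal_submat \<Psi> Q) * J (int Nr) \<theta>s
                         * complex_of_real (fact (Nr - L) / fact (Nr - t))))
     in C \<le> ennreal (log 2 (Re bound)))"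
proof -
  let ?M = "Mh * Mv" and ?\<rho> = "\<rho> / real Nt"
  have T: "LoS_T Mh Mv Nt dhl dvl dtl PT tg phA1 thA1 thD1 \<in> carrier_mat ?M Nt"
    by (simp add: LoS_T_def)
  have Rb: "LoS_R Mh Mv Nr dhl dvl drl PR rg thA2 phD2 thD2 \<in> carrier_mat Nr ?M"
    by (simp add: LoS_R_def)
  have Hb: "LoS_H Nr Nt drl dtl PH hg thA3 thD3 \<in> carrier_mat Nr Nt"
    by (simp add: LoS_H_def)
  have "0 \<le> bt * br" "0 \<le> ?\<rho>" "1 < (2 :: real)"
    using assms by simp_all
  note rows = independent_rows_ris_channel[OF T Rb Hb \<open>Nt \<le> Nr\<close>
      \<open>0 \<le> bt * br\<close> \<open>0 \<le> NR\<close> \<open>0 < bd\<close> \<open>0 < NH\<close>, of LR phase LH]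
  show ?thesis
    using independent_rows.nn_integral_log_det_one_plus_gram_le[OF rows \<open>0 \<le> ?\<rho>\<close> \<open>1 < 2\<close>]
    unfolding sum_expected_gram_minor Let_def .
qed

end
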